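(* Let $\mathcal{S}=\{S_i\}_{i=0}^n$ be an iterated function system on $\mathbb{R}^d$ with $S_i(x)=r_iA_ix+d_i$, where $0<r_i<1$, $A_i$ is an orthogonal matrix and $d_i\in\mathbb{R}^d$. Assume that the attractor of $\mathcal{S}$ is $K=[-1/2,1/2]^d$ and that each $A_i$ fixes $[-1/2,1/2]^d$, i.e. $A_i([-1/2,1/2]^d)=[-1/2,1/2]^d$. If $\mathcal{S}$ satisfies the weak separation condition, then $\mathcal{S}$ satisfies the convex generalized finite type condition (GFTC$_{\mathrm{co}}$).
   Context: The attractor of $\mathcal{S}$ is the unique non-empty compact set $K$ with $K=\bigcup_i S_i(K)$. Words: for a finite non-empty word $\sigma=(\sigma_1,\dots,\sigma_j)$ over the index set, $\sigma^-=(\sigma_1,\dots,\sigma_{j-1})$, $S_\sigma=S_{\sigma_1}\circ\cdots\circ S_{\sigma_j}$, $r_\sigma=\prod_{i=1}^j r_{\sigma_i}$; for the empty word $\epsilon$, $S_\epsilon=\mathrm{Id}$ and $r_\epsilon=1$. For $\alpha>0$, $\Lambda_\alpha$ is the set of (non-empty) finite words $\sigma$ with $r_\sigma<\alpha\le r_{\sigma^-}$. Weak separation condition (WSC): there are $x_0\in\mathbb{R}^d$ and an integer $N$ such that for every $\alpha>0$ and every finite word $\tau$, any closed ball of radius $\alpha$ contains at most $N$ distinct points of the form $S_\sigma(S_\tau(x_0))$ with $\sigma\in\Lambda_\alpha$. For $V\subset\mathbb{R}^d$ let $\mathcal{E}_{\mathcal{S}}(V)=\bigcup_{\alpha>0}\{S_\sigma^{-1}\circ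 S_\tau:\sigma,\tau\in\Lambda_\alpha,\ S_\sigma(V)\cap S_\tau(V)\neq\emptyset\}$. A set $V$ is invariant if $S_i(V)\subset V$ for all $i$. The generalized finite type condition (GFTC) holds with the non-empty bounded invariant open set $V$ if $\mathcal{E}_{\mathcal{S}}(V)$ is finite. GFTC$_{\mathrm{co}}$ means GFTC holds with $V$ the interior of the convex hull of $K$; here $V=(-1/2,1/2)^d$. *)

theory Defs
  imports "HOL-Analysis.Analysis"
begin

text \<open>
  An iterated function system \<open>S\<^sub>0, \<dots>, S\<^sub>n\<close> of similarities is given by the largest index \<open>n\<close>,
  the contraction ratios \<open>r\<close> and the maps \<open>S\<close>, both as functions on \<open>nat\<close> of which only
  the values at indices \<open>\<le> n\<close> matter.
\<close>

definition is_attractor :: "nat \<Rightarrow> (nat \<Rightarrow> 'a::euclidean_space \<Rightarrow> 'a) \<Rightarrow> 'a set \<Rightarrow> bool" where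
  "is_attractor n S K \<longleftrightarrow> K \<noteq> {} \<and> compact K \<and> K = (\<Union>i\<in>{0..n}. S i ` K)"

text \<open>The description is justified for contractive systems by \<open>attractor_eqI\<close> below.\<close>

definition attractor :: "nat \<Rightarrow> (nat \<Rightarrow> 'a::euclidean_space \<Rightarrow> 'a) \<Rightarrow> 'a set" where
  "attractor n S = (THE K. is_attractor n S K)"

lemma is_attractor_subset:
  fixes S :: "nat \<Rightarrow> 'a::euclidean_space \<Rightarrow> 'a"
  assumes r: "\<And>i. i \<le> n \<Longrightarrow> 0 \<le> r i \<and> r i < 1"
    and lip: "\<And>i x y. i \<le> n \<Longrightarrow> dist (S i x) (S i y) \<le> r i * dist x y"
    and K: "is_attractor n S K" and L: "is_attractor n S L"
  shows "K \<subseteq> L"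
proof -
  have L': "L \<noteq> {}" "compact L" "L = (\<Union>i\<in>{0..n}. S i ` L)"
    and K': "K \<noteq> {}" "compact K" "K = (\<Union>i\<in>{0..n}. S i ` K)"
    using K L unfolding is_attractor_def by blast+
  have "continuous_on K (\<lambda>x. infdist x L)"
    by (intro continuous_intros)
  then obtain x where x: "x \<in> K" and max: "\<And>y. y \<in> K \<Longrightarrow> infdist y L \<le> infdist x L"
    using continuous_attains_sup[OF K'(2,1)] by blast
  have "x \<in> (\<Union>i\<in>{0..n}. S i ` K)"
    using x by (subst (asm) K'(3))
  then obtain i y where i: "i \<le> n" and y: "y \<in> K" "x = S i y"
    by auto
  obtain z where z: "z \<in> L" "infdist y L = dist y z"
    using infdist_attains_inf[OF compact_imp_closed[OF L'(2)] L'(1)] by metis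
  have "S i z \<in> (\<Union>i\<in>{0..n}. S i ` L)" using z(1) i by auto
  then have "S i z \<in> L" by (subst L'(3))
  then have "infdist x L \<le> dist (S i y) (S i z)"
    unfolding y(2) by (rule infdist_le)
  also have "\<dots> \<le> r i * infdist y L"
    unfolding z(2) by (rule lip[OF i])
  also have "\<dots> \<le> r i * infdist x L"
    using max[OF y(1)] r[OF i] by (intro mult_left_mono) auto
  finally have "(1 - r i) * infdist x L \<le> 0" by (simp add: algebra_simps)
  then have "infdist x L \<le> 0"
    using r[OF i] by (simp add: mult_le_0_iff)
  then have "infdist y L = 0" if "y \<in> K" for y
    using max[OF that] infdist_nonneg[of y L] by linarith
  then show ?thesis
    using in_closed_iff_infdist_zero[OF compact_imp_closed[OF L'(2)] L'(1)] by blast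
qed

lemma attractor_eqI:
  fixes S :: "nat \<Rightarrow> 'a::euclidean_space \<Rightarrow> 'a"
  assumes "\<And>i. i \<le> n \<Longrightarrow> 0 \<le> r i \<and> r i < 1"
    and "\<And>i x y. i \<le> n \<Longrightarrow> dist (S i x) (S i y) \<le> r i * dist x y"
    and "is_attractor n S K"
  shows "attractor n S = K"
  unfolding attractor_def
proof (rule the_equality)
  show "is_attractor n S K" by fact
next
  fix L assume "is_attractor n S L"
  then show "L = K"
    using is_attractor_subset[where r = r and S = S and n = n, OF assms(1,2)] assms(3)
    by (meson subset_antisym)
qed

text \<open>Finite words over the index set; the empty word is included.\<close>

definition words :: "nat \<Rightarrow> nat list set" where
  "words n = lists {0..n}"

fun word_map :: "(nat \<Rightarrow> 'a \<Rightarrow> 'a) \<Rightarrow> nat list \<Rightarrow> 'a \<Rightarrow> 'a" where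
  "word_map S [] = id"
| "word_map S (i # \<sigma>) = S i \<circ> word_map S \<sigma>"

definition word_ratio :: "(nat \<Rightarrow> real) \<Rightarrow> nat list \<Rightarrow> real" where
  "word_ratio r \<sigma> = prod_list (map r \<sigma>)"

definition Lambda :: "nat \<Rightarrow> (nat \<Rightarrow> real) \<Rightarrow> real \<Rightarrow> nat list set" where
  "Lambda n r \<alpha> =
     {\<sigma> \<in> words n. \<sigma> \<noteq> [] \<and> word_ratio r \<sigma> < \<alpha> \<and> \<alpha> \<le> word_ratio r (butlast \<sigma>)}"

definition weak_separation ::
    "nat \<Rightarrow> (nat \<Rightarrow> real) \<Rightarrow> (nat \<Rightarrow> 'a::euclidean_space \<Rightarrow> 'a) \<Rightarrow> bool" where
  "weak_separation n r S \<longleftrightarrow>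
     (\<exists>x0 N. \<forall>\<alpha>>0. \<forall>\<tau>\<in>words n. \<forall>c.
        let P = (\<lambda>\<sigma>. word_map S \<sigma> (word_map S \<tau> x0)) ` Lambda n r \<alpha> \<inter> cball c \<alpha>
        in finite P \<and> card P \<le> N)"

text \<open>
  The set \<open>\<E>\<^sub>S(V)\<close>. Its elements are compared as functions; \<open>inv\<close> is the genuine inverse since
  the maps \<open>S\<^sub>i\<close> are bijections of the whole space in the intended use.
\<close>

definition neighbour_maps ::
    "nat \<Rightarrow> (nat \<Rightarrow> real) \<Rightarrow> (nat \<Rightarrow> 'a \<Rightarrow> 'a) \<Rightarrow> 'a set \<Rightarrow> ('a \<Rightarrow> 'a) set" where
  "neighbour_maps n r S V =
     (\<Union>\<alpha>\<in>{0<..}. {inv (word_map S \<sigma>) \<circ> word_map S \<tau> | \<sigma> \<tau>.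
        \<sigma> \<in> Lambda n r \<alpha> \<and> \<tau> \<in> Lambda n r \<alpha> \<and>
        word_map S \<sigma> ` V \<inter> word_map S \<tau> ` V \<noteq> {}})"

definition gftc ::
    "nat \<Rightarrow> (nat \<Rightarrow> real) \<Rightarrow> (nat \<Rightarrow> 'a::euclidean_space \<Rightarrow> 'a) \<Rightarrow> 'a set \<Rightarrow> bool" where
  "gftc n r S V \<longleftrightarrow>
     V \<noteq> {} \<and> bounded V \<and> open V \<and> (\<forall>i\<le>n. S i ` V \<subseteq> V) \<and> finite (neighbour_maps n r S V)"

definition gftc_co ::
    "nat \<Rightarrow> (nat \<Rightarrow> real) \<Rightarrow> (nat \<Rightarrow> 'a::euclidean_space \<Rightarrow> 'a) \<Rightarrow> bool" where
  "gftc_co n r S \<longleftrightarrow> gftc n r S (interior (convex hull (attractor n S)))"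

definition unit_cube :: "(real ^ 'd) set" where
  "unit_cube = cbox (\<chi> i. - 1/2) (\<chi> i. 1/2)"

end

theory Submission
  imports Defs
begin

text \<open>
  The maps \<open>S\<^sub>\<sigma>\<close> send the cube to axis-parallel cubes (cells), and their linear parts take only
  finitely many values. So it suffices to bound the relative positions of two cells of the same
  level \<open>\<alpha>\<close> whose interiors meet.

  By the weak separation condition there are boundedly many cells of level \<open>\<alpha>\<close> near a point.
  Choosing a point and a level with the maximal number of cells through it, and copying this
  configuration into the overlap of two cells, one sees that only finitely many relative
  positions occur for cells whose overlap has width at least \<open>c \<alpha>\<close> in every coordinate.

  It remains to bound the widths of an overlap from below, by induction on the number of
  coordinates in which it is tiny. Among the pairs of cells with the same overlap in these
  coordinates, take one whose words have the longest common prefix \<open>w\<close>, continued by \<open>i\<close> and \<open>j\<close>.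
  The overlap of \<open>S\<^sub>w\<^sub>i(K)\<close> and \<open>S\<^sub>w\<^sub>j(K)\<close> is not tiny, so it extends beyond the given one in some
  direction, say inside \<open>S\<^sub>w\<^sub>i(K)\<close> beyond the first cell. A cell of \<open>S\<^sub>w\<^sub>i(K)\<close> just beyond that face must, by
  the induction hypothesis and discreteness of the relative positions, either overlap both cells
  substantially, making their overlap large, or be exactly aligned with the second cell,
  giving a pair with a longer common prefix.
\<close>

section \<open>Linear isometries of the cube\<close>

definition cube_isometries :: "(real ^ 'd ^ 'd) set" where
  "cube_isometries = {M. orthogonal_matrix M \<and> (\<lambda>x. M *v x) ` unit_cube = unit_cube}"

lemma mem_unit_cube: "x \<in> unit_cube \<longleftrightarrow> (\<forall>k. \<bar>x $ k\<bar> \<le> 1/2)"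
proof -
  have "(- 1/2 \<le> x $ k \<and> x $ k \<le> 1/2) = (\<bar>x $ k\<bar> \<le> 1/2)" for k by linarith
  then show ?thesis unfolding unit_cube_def mem_box_cart by simp
qed

text \<open>These are the signed permutation matrices. A row has l1 norm at most 1, because the cube
  is preserved, and Euclidean norm 1, by orthogonality. Hence the squares of the absolute values of
  its entries must equal the absolute values, which leaves only -1, 0 and 1.\<close>

lemma finite_cube_isometries: "finite (cube_isometries :: (real ^ 'd ^ 'd) set)"
proof -
  have entry: "M $ i $ j \<in> {-1, 0, 1}" if M: "M \<in> cube_isometries" for M :: "real ^ 'd ^ 'd" and i j
  proof -
    \<comment> \<open>A point of the cube at which the \<open>i\<close>-th component of
      \<open>M *v x\<close> is half the l1 norm of row \<open>i\<close>.\<close>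
    define x :: "real ^ 'd" where "x = (\<chi> j. sgn (M $ i $ j) / 2)"
    have "x \<in> unit_cube" by (auto simp: mem_unit_cube x_def abs_sgn_eq)
    then have "M *v x \<in> unit_cube" using M by (auto simp: cube_isometries_def)
    then have "\<bar>(M *v x) $ i\<bar> \<le> 1/2" by (simp add: mem_unit_cube)
    moreover have "(M *v x) $ i = (\<Sum>j\<in>UNIV. \<bar>M $ i $ j\<bar>) / 2"
      unfolding matrix_vector_mult_def x_def
      by (simp add: sum_divide_distrib abs_sgn)
    ultimately have l1: "(\<Sum>j\<in>UNIV. \<bar>M $ i $ j\<bar>) \<le> 1" by linarith
    have "M ** transpose M = mat 1"
      using M by (simp add: cube_isometries_def orthogonal_matrix_def)
    then have "(M ** transpose M) $ i $ i = 1" by (simp add: mat_def)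
    then have l2: "(\<Sum>j\<in>UNIV. \<bar>M $ i $ j\<bar>\<^sup>2) = 1"
      by (simp add: matrix_matrix_mult_def transpose_def power2_eq_square)
    have le1: "\<bar>M $ i $ j\<bar> \<le> 1" for j
      using member_le_sum[of j UNIV "\<lambda>j. \<bar>M $ i $ j\<bar>"] l1 by simp
    have nonneg: "0 \<le> \<bar>M $ i $ j\<bar> - \<bar>M $ i $ j\<bar>\<^sup>2" for j
      using le1[of j] mult_left_le[of "\<bar>M $ i $ j\<bar>" "\<bar>M $ i $ j\<bar>"] by (simp add: power2_eq_square)
    have "(\<Sum>j\<in>UNIV. \<bar>M $ i $ j\<bar> - \<bar>M $ i $ j\<bar>\<^sup>2) \<le> 0"
      using l1 l2 by (simp add: sum_subtractf)
    then have "(\<Sum>j\<in>UNIV. \<bar>M $ i $ j\<bar> - \<bar>M $ i $ j\<bar>\<^sup>2) = 0"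
      using nonneg by (meson order_antisym sum_nonneg)
    then have "\<bar>M $ i $ j\<bar> - \<bar>M $ i $ j\<bar>\<^sup>2 = 0"
      using sum_nonneg_eq_0_iff[of UNIV "\<lambda>j. \<bar>M $ i $ j\<bar> - \<bar>M $ i $ j\<bar>\<^sup>2"] nonneg
      by (metis UNIV_I finite)
    then have "\<bar>M $ i $ j\<bar> * (1 - \<bar>M $ i $ j\<bar>) = 0"
      unfolding power2_eq_square right_diff_distrib by (simp only: mult_1_right)
    then have "\<bar>M $ i $ j\<bar> = 0 \<or> 1 - \<bar>M $ i $ j\<bar> = 0" by (simp only: mult_eq_0_iff)
    then show ?thesis by auto
  qed
  define F where "F = (\<lambda>f. (\<chi> i j. f (i, j)) :: real ^ 'd ^ 'd)"
  have "finite (PiE (UNIV :: ('d \<times> 'd) set) (\<lambda>_. {-1, 0, 1 :: real}))"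
    by (rule finite_PiE) auto
  moreover have "M \<in> F ` PiE UNIV (\<lambda>_. {-1, 0, 1})" if "M \<in> cube_isometries" for M
  proof
    show "M = F (\<lambda>(i, j). M $ i $ j)" by (simp add: F_def vec_eq_iff)
    show "(\<lambda>(i, j). M $ i $ j) \<in> PiE UNIV (\<lambda>_. {-1, 0, 1})"
      using entry[OF that] by (simp add: PiE_UNIV_domain Pi_def split: prod.splits)
  qed
  ultimately show ?thesis
    by (meson finite_imageI rev_finite_subset subsetI)
qed

lemma cube_isometries_mult:
  "M \<in> cube_isometries \<Longrightarrow> M' \<in> cube_isometries \<Longrightarrow> M ** M' \<in> cube_isometries"
  unfolding cube_isometries_def
  by (auto simp: orthogonal_matrix_mul image_image[symmetric] simp flip: matrix_vector_mul_assoc)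

lemma one_in_cube_isometries: "mat 1 \<in> cube_isometries"
  by (simp add: cube_isometries_def orthogonal_matrix_id)

lemma norm_cube_isometry:
  "M \<in> cube_isometries \<Longrightarrow> norm (M *v x) = norm x"
  using orthogonal_transformation_matrix[of "\<lambda>x. M *v x"]
  by (auto simp: cube_isometries_def orthogonal_transformation)

section \<open>Intervals and finite sets of reals\<close>

lemma finite_nonzero_bounded_below:
  fixes Z :: "real set"
  assumes "finite Z"
  shows "\<exists>g>0. \<forall>z\<in>Z. z \<noteq> 0 \<longrightarrow> g \<le> \<bar>z\<bar>"
  using assms
proof (induction Z)
  case empty
  show ?case by (intro exI[of _ 1]) auto
next
  case (insert a Z)
  then obtain g where "g > 0" "\<forall>z\<in>Z. z \<noteq> 0 \<longrightarrow> g \<le> \<bar>z\<bar>" by blast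
  then show ?case
    by (intro exI[of _ "if a = 0 then g else min g \<bar>a\<bar>"]) auto
qed

text \<open>Each point costs at most half of the current interval, so the loss depends only on the
  number of points and not on their positions.\<close>

lemma subinterval_avoiding_finite:
  fixes H :: "real set"
  assumes "finite H" "card H \<le> N" "a \<le> b"
  shows "\<exists>u v. a \<le> u \<and> v \<le> b \<and> (b - a) / 2 ^ N \<le> v - u \<and> H \<inter> {u<..<v} = {}"
  using assms(1,2)
proof (induction H arbitrary: N)
  case empty
  have "(b - a) / 2 ^ N \<le> b - a" using assms(3) by (simp add: divide_le_eq mult_left_le_imp_le)
    (metis diff_ge_0_iff_ge mult_left_le mult.commute mult_1 one_le_numeral one_le_power mult_left_mono)
  then show ?case by (intro exI[of _ a] exI[of _ b]) auto
next
  case (insert h H)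
  then obtain N' where N: "N = Suc N'" "card H \<le> N'" by (cases N) auto
  obtain u v where uv: "a \<le> u" "v \<le> b" "(b - a) / 2 ^ N' \<le> v - u" "H \<inter> {u<..<v} = {}"
    using insert.IH[OF N(2)] by blast
  have half: "(b - a) / 2 ^ N = ((b - a) / 2 ^ N') / 2" by (simp add: N)
  have pos: "0 \<le> (b - a) / 2 ^ N'" using assms(3) by simp
  consider "h \<le> u \<or> v \<le> h" | "u < h" "h < v" "(v - u) / 2 \<le> h - u" | "u < h" "h < v" "(v - u) / 2 \<le> v - h"
    by argo
  then show ?case
  proof cases
    case 1
    then have "insert h H \<inter> {u<..<v} = {}" using uv(4) by auto
    then show ?thesis using uv half pos by (intro exI[of _ u] exI[of _ v]) auto
  next
    case 2
    then have "insert h H \<inter> {u<..<h} = {}" using uv(4) by auto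
    then show ?thesis using uv half 2 by (intro exI[of _ u] exI[of _ h]) auto
  next
    case 3
    then have "insert h H \<inter> {h<..<v} = {}" using uv(4) by auto
    then show ?thesis using uv half 3 by (intro exI[of _ h] exI[of _ v]) auto
  qed
qed

lemma right_neighbourhood_avoiding_finite:
  fixes H :: "real set"
  assumes "finite H" "p < b"
  shows "\<exists>y. p < y \<and> y < b \<and> H \<inter> {p<..y} = {}"
  using assms(1)
proof (induction H)
  case empty
  show ?case using dense[OF assms(2)] by auto
next
  case (insert h H)
  then obtain y where y: "p < y" "y < b" "H \<inter> {p<..y} = {}" by blast
  show ?case
  proof (cases "p < h \<and> h \<le> y")
    case True
    then obtain z where "p < z" "z < h" using dense by blast
    then show ?thesis using y True by (intro exI[of _ z]) auto
  next
    case False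
    then show ?thesis using y by (intro exI[of _ y]) auto
  qed
qed

lemma left_neighbourhood_avoiding_finite:
  fixes H :: "real set"
  assumes "finite H" "b < q"
  shows "\<exists>y. y < q \<and> b < y \<and> H \<inter> {y..<q} = {}"
proof -
  obtain y where y: "- q < y" "y < - b" "uminus ` H \<inter> {- q<..y} = {}"
    using right_neighbourhood_avoiding_finite[of "uminus ` H" "- q" "- b"] assms by auto
  have "h \<notin> {- y..<q}" if "h \<in> H" for h
    using y(3) that by force
  then show ?thesis using y by (intro exI[of _ "- y"]) auto
qed

text \<open>Projections to one axis: the cells \<open>[ls, hs]\<close> and \<open>[lt, ht]\<close> have the tiny overlap \<open>[a, b]\<close>,
  which the cell \<open>[lk, hk]\<close> touches.\<close>

context
  fixes ls hs lt ht lk hk a b M E :: real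
  assumes ab: "max ls lt = a" "min hs ht = b" "a < b" "b - a < E" "E \<le> M / 4"
    and len: "M \<le> hs - ls" "M \<le> ht - lt" "M \<le> hk - lk"
    and touch: "lk \<le> b" "a \<le> hk"
begin

text \<open>Neither interval can be the overlap itself, which is shorter than both. So one of them
  sticks out to the left only and the other to the right only.\<close>

lemma tiny_overlap_orientation: "(ls < a \<and> lt = a \<and> hs = b \<and> b < ht) \<or> (lt < a \<and> ls = a \<and> ht = b \<and> b < hs)"
  using ab len by (auto simp: min_def max_def split: if_splits)

text \<open>Having length at least \<open>M\<close> and touching \<open>[a, b]\<close>, the third
  interval runs far past the overlap on one side, and on that side lies one of the two long
  intervals.\<close>

lemma big_overlap_with_one:
  "M / 4 \<le> min hk hs - max lk ls \<or> M / 4 \<le> min hk ht - max lk lt"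
  using tiny_overlap_orientation
  by (rule disjE) (use ab(3-5) len touch in \<open>simp add: min_def max_def; linarith\<close>)+

text \<open>At \<open>y\<close> the third interval leaves \<open>[ls, hs]\<close> on the side
  covered by \<open>[lt, ht]\<close>. By the gap between endpoints it does so by at least
  \<open>C\<close>, which already gives an overlap of length \<open>C\<close> with
  \<open>[lt, ht]\<close>.\<close>

lemma no_protrusion:
  assumes "lk \<le> y" "y \<le> hk" "y < ls \<or> hs < y" "lt < y" "y < ht"
    "min hk ht - max lk lt < C" "C \<le> M / 4"
    "lk \<noteq> ls \<Longrightarrow> C \<le> \<bar>lk - ls\<bar>" "hk \<noteq> hs \<Longrightarrow> C \<le> \<bar>hk - hs\<bar>"
  shows False
  using tiny_overlap_orientation
  by (rule disjE) (use ab(3-5) len touch assms in \<open>simp add: min_def max_def split: if_splits; linarith\<close>)+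

text \<open>Touching \<open>[ls, hs]\<close> in a single point would put an endpoint of the third
  interval at positive distance less than \<open>E\<close> from the corresponding endpoint of
  \<open>[lt, ht]\<close>.\<close>

lemma proper_overlap:
  assumes "lk \<noteq> lt \<Longrightarrow> G \<le> \<bar>lk - lt\<bar>" "hk \<noteq> ht \<Longrightarrow> G \<le> \<bar>hk - ht\<bar>" "E \<le> G"
  shows "0 < min hs hk - max ls lk"
  using tiny_overlap_orientation
proof (rule disjE)
  assume "ls < a \<and> lt = a \<and> hs = b \<and> b < ht"
  then show ?thesis using ab(3-5) len touch assms by (simp add: min_def max_def) linarith
next
  assume "lt < a \<and> ls = a \<and> ht = b \<and> b < hs"
  then show ?thesis using ab(3-5) len touch assms by (simp add: min_def max_def) linarith
qed

text \<open>The endpoint of \<open>[lt, ht]\<close> that bounds the overlap is also one of the third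
  interval: otherwise the latter would extend by \<open>G\<close> further into
  \<open>[ls, hs]\<close>, making their overlap at least \<open>C\<close>.\<close>

lemma same_overlap:
  assumes "lk \<noteq> lt \<Longrightarrow> G \<le> \<bar>lk - lt\<bar>" "hk \<noteq> ht \<Longrightarrow> G \<le> \<bar>hk - ht\<bar>" "E \<le> G"
    "min hs hk - max ls lk < C" "C \<le> G" "C \<le> M / 4"
  shows "max ls lk = a \<and> min hs hk = b"
  using tiny_overlap_orientation
proof (rule disjE)
  assume "ls < a \<and> lt = a \<and> hs = b \<and> b < ht"
  then show ?thesis using ab(3-5) len touch assms by (simp add: min_def max_def split: if_splits) linarith
next
  assume "lt < a \<and> ls = a \<and> ht = b \<and> b < hs"
  then show ?thesis using ab(3-5) len touch assms by (simp add: min_def max_def split: if_splits) linarith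
qed

end

subsection \<open>Cells\<close>

locale cube_ifs =
  fixes n :: nat
    and r :: "nat \<Rightarrow> real"
    and A :: "nat \<Rightarrow> real ^ 'd ^ 'd"
    and t :: "nat \<Rightarrow> real ^ 'd"
    and S :: "nat \<Rightarrow> real ^ 'd \<Rightarrow> real ^ 'd"
  assumes S: "\<And>i x. i \<le> n \<Longrightarrow> S i x = r i *\<^sub>R (A i *v x) + t i"
    and ratio: "\<And>i. i \<le> n \<Longrightarrow> 0 < r i \<and> r i < 1"
    and orth: "\<And>i. i \<le> n \<Longrightarrow> orthogonal_matrix (A i)"
    and attr: "is_attractor n S unit_cube"
    and fixes_cube: "\<And>i. i \<le> n \<Longrightarrow> (\<lambda>x. A i *v x) ` unit_cube = unit_cube"
    and wsc: "weak_separation n r S"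
begin

abbreviation rat :: "nat list \<Rightarrow> real" where
  "rat \<equiv> word_ratio r"

primrec lin :: "nat list \<Rightarrow> real ^ 'd ^ 'd" where
  "lin [] = mat 1"
| "lin (i # u) = A i ** lin u"

primrec centre :: "nat list \<Rightarrow> real ^ 'd" where
  "centre [] = 0"
| "centre (i # u) = r i *\<^sub>R (A i *v centre u) + t i"

definition lo :: "nat list \<Rightarrow> 'd \<Rightarrow> real" where
  "lo u k = centre u $ k - rat u / 2"

definition hi :: "nat list \<Rightarrow> 'd \<Rightarrow> real" where
  "hi u k = centre u $ k + rat u / 2"

definition cell :: "nat list \<Rightarrow> (real ^ 'd) set" where
  "cell u = {x. \<forall>k. lo u k \<le> x $ k \<and> x $ k \<le> hi u k}"

text \<open>Negative when the projections of the two cells to the \<open>k\<close>-th axis are disjoint.\<close>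

definition width :: "nat list \<Rightarrow> nat list \<Rightarrow> 'd \<Rightarrow> real" where
  "width u v k = min (hi u k) (hi v k) - max (lo u k) (lo v k)"

text \<open>Size and position of the second cell in units of the first. Linear parts are left out,
  since they contribute only finitely many possibilities.\<close>

definition rel :: "nat list \<Rightarrow> nat list \<Rightarrow> real \<times> (real ^ 'd)" where
  "rel u v = (rat v / rat u, (1 / rat u) *\<^sub>R (centre v - centre u))"

definition rmin :: real where "rmin = Min (r ` {0..n})"
definition rmax :: real where "rmax = Max (r ` {0..n})"

lemma rmin: "0 < rmin" "rmin < 1" "i \<le> n \<Longrightarrow> rmin \<le> r i"
proof -
  have "rmin \<in> r ` {0..n}" unfolding rmin_def by (rule Min_in) auto
  then show "0 < rmin" "rmin < 1" using ratio by auto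
  show "i \<le> n \<Longrightarrow> rmin \<le> r i" unfolding rmin_def by (rule Min_le) auto
qed

lemma rmax: "0 < rmax" "rmax < 1" "i \<le> n \<Longrightarrow> r i \<le> rmax"
proof -
  have "rmax \<in> r ` {0..n}" unfolding rmax_def by (rule Max_in) auto
  then show "0 < rmax" "rmax < 1" using ratio by auto
  show "i \<le> n \<Longrightarrow> r i \<le> rmax" unfolding rmax_def by (rule Max_ge) auto
qed

lemma words_Cons [simp]: "i # u \<in> words n \<longleftrightarrow> i \<le> n \<and> u \<in> words n"
  by (auto simp: words_def)

lemma words_Nil [simp]: "[] \<in> words n"
  by (auto simp: words_def)

lemma words_append [simp]: "u @ v \<in> words n \<longleftrightarrow> u \<in> words n \<and> v \<in> words n"
  by (auto simp: words_def)

lemma rat_Nil [simp]: "rat [] = 1" and rat_Cons [simp]: "rat (i # u) = r i * rat u"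
  and rat_append [simp]: "rat (u @ v) = rat u * rat v"
  by (auto simp: word_ratio_def)

lemma rat_pos [simp]: "u \<in> words n \<Longrightarrow> 0 < rat u"
  by (induction u) (auto simp: ratio)

lemma rat_le_rmax: "u \<in> words n \<Longrightarrow> rat u \<le> rmax ^ length u"
proof (induction u)
  case (Cons i u)
  then show ?case using rmax ratio[of i] rat_pos[of u]
    by (auto intro!: mult_mono less_imp_le[OF rat_pos])
qed auto

lemma rat_le_1: "u \<in> words n \<Longrightarrow> rat u \<le> 1"
  using rat_le_rmax[of u] rmax power_le_one[of rmax "length u"] by linarith

lemma lin_in: "u \<in> words n \<Longrightarrow> lin u \<in> cube_isometries"
proof (induction u)
  case Nil
  show ?case by (simp add: one_in_cube_isometries)
next
  case (Cons i u)
  then have "A i \<in> cube_isometries"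
    using orth[of i] fixes_cube[of i] by (simp add: cube_isometries_def)
  then show ?case using Cons by (simp add: cube_isometries_mult)
qed

lemma word_map_eq:
  "u \<in> words n \<Longrightarrow> word_map S u x = rat u *\<^sub>R (lin u *v x) + centre u"
  by (induction u)
    (auto simp: S matrix_vector_right_distrib matrix_vector_mult_scaleR matrix_vector_mul_assoc
        scaleR_add_right)

lemma centre_append:
  assumes "u \<in> words n" "v \<in> words n"
  shows "centre (u @ v) = rat u *\<^sub>R (lin u *v centre v) + centre u"
  using assms
  by (induction u)
    (auto simp: S matrix_vector_right_distrib matrix_vector_mult_scaleR matrix_vector_mul_assoc
        scaleR_add_right)

lemma word_map_append: "word_map S (u @ v) x = word_map S u (word_map S v x)"
  by (induction u) auto

text \<open>The linear part preserves the cube, so only a scaling and a translation remain.\<close>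

lemma image_cell:
  assumes "u \<in> words n"
  shows "word_map S u ` unit_cube = cell u"
proof -
  have "word_map S u ` unit_cube = (\<lambda>y. rat u *\<^sub>R y + centre u) ` ((\<lambda>x. lin u *v x) ` unit_cube)"
    using assms by (simp add: image_image word_map_eq)
  also have "\<dots> = (\<lambda>y. rat u *\<^sub>R y + centre u) ` unit_cube"
    using lin_in[OF assms] by (simp add: cube_isometries_def)
  also have "\<dots> = cell u"
  proof (intro equalityI subsetI)
    fix x assume "x \<in> (\<lambda>y. rat u *\<^sub>R y + centre u) ` unit_cube"
    then obtain y where y: "x = rat u *\<^sub>R y + centre u" and "y \<in> unit_cube" by blast
    then have bound: "\<bar>y $ k\<bar> \<le> 1/2" for k by (simp add: mem_unit_cube)
    have "\<bar>rat u * y $ k\<bar> \<le> rat u / 2" for k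
      using bound[of k] rat_pos[OF assms] by (simp add: abs_mult)
    then have "\<bar>x $ k - centre u $ k\<bar> \<le> rat u / 2" for k by (simp add: y)
    then show "x \<in> cell u"
      unfolding cell_def lo_def hi_def abs_le_iff by (simp, smt (verit))
  next
    fix x assume x: "x \<in> cell u"
    have "x = rat u *\<^sub>R ((1 / rat u) *\<^sub>R (x - centre u)) + centre u"
      using rat_pos[OF assms] by simp
    moreover have "\<bar>x $ k - centre u $ k\<bar> / rat u \<le> 1/2" for k
    proof -
      have "lo u k \<le> x $ k" "x $ k \<le> hi u k" using x by (auto simp: cell_def)
      then have "\<bar>x $ k - centre u $ k\<bar> \<le> rat u / 2" unfolding lo_def hi_def by linarith
      then show ?thesis using rat_pos[OF assms] by (simp add: divide_le_eq)
    qed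
    then have "(1 / rat u) *\<^sub>R (x - centre u) \<in> unit_cube"
      using rat_pos[OF assms] by (auto simp: mem_unit_cube abs_mult)
    ultimately show "x \<in> (\<lambda>y. rat u *\<^sub>R y + centre u) ` unit_cube" by blast
  qed
  finally show ?thesis .
qed

lemma unit_cube_eq: "unit_cube = (\<Union>i\<in>{0..n}. S i ` unit_cube)"
  using attr unfolding is_attractor_def by blast

lemma word_map_unit_cube: "u \<in> words n \<Longrightarrow> word_map S u ` unit_cube \<subseteq> unit_cube"
proof (induction u)
  case (Cons i u)
  have "S i ` unit_cube \<subseteq> unit_cube"
    using Cons.prems by (subst (2) unit_cube_eq) auto
  then show ?case using Cons by (fastforce simp: image_comp[symmetric])
qed auto

lemma cell_append_subset:
  assumes "u \<in> words n" "v \<in> words n"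
  shows "cell (u @ v) \<subseteq> cell u"
proof -
  have "cell (u @ v) = word_map S u ` word_map S v ` unit_cube"
    using assms by (simp add: image_cell[symmetric] image_image word_map_append)
  also have "\<dots> \<subseteq> word_map S u ` unit_cube"
    using word_map_unit_cube[OF assms(2)] by blast
  finally show ?thesis using assms by (simp add: image_cell)
qed

lemma lo_hi_append:
  assumes "u \<in> words n" "v \<in> words n"
  shows "lo u k \<le> lo (u @ v) k" "hi (u @ v) k \<le> hi u k"
proof -
  have pos: "0 < rat (u @ v)" using assms by (intro rat_pos) simp
  have "(\<chi> k. lo (u @ v) k) \<in> cell (u @ v)" "(\<chi> k. hi (u @ v) k) \<in> cell (u @ v)"
    using pos by (auto simp: cell_def lo_def hi_def)
  then have "(\<chi> k. lo (u @ v) k) \<in> cell u" "(\<chi> k. hi (u @ v) k) \<in> cell u"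
    using cell_append_subset[OF assms] by auto
  then show "lo u k \<le> lo (u @ v) k" "hi (u @ v) k \<le> hi u k"
    by (auto simp: cell_def)
qed

lemma cell_snoc:
  assumes "u \<in> words n" "x \<in> cell u"
  shows "\<exists>i\<le>n. x \<in> cell (u @ [i])"
proof -
  obtain y where y: "y \<in> unit_cube" "x = word_map S u y"
    using assms image_cell by blast
  have "y \<in> (\<Union>i\<in>{0..n}. S i ` unit_cube)" using y(1) by (subst (asm) unit_cube_eq)
  then obtain i z where i: "i \<le> n" "z \<in> unit_cube" "y = S i z" by auto
  then have "x = word_map S (u @ [i]) z" by (simp add: y word_map_append)
  then have "x \<in> cell (u @ [i])" using i assms by (auto simp: image_cell[symmetric])
  then show ?thesis using i by blast
qed

section \<open>Words of a given level\<close>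

lemma Lambda_words: "u \<in> Lambda n r \<alpha> \<Longrightarrow> u \<in> words n"
  by (simp add: Lambda_def)

lemma Lambda_rat:
  assumes "u \<in> Lambda n r \<alpha>" "0 < \<alpha>"
  shows "rat u < \<alpha>" "rmin * \<alpha> \<le> rat u" "0 < rat u"
proof -
  obtain v i where u: "u = v @ [i]"
    using assms(1) by (cases u rule: rev_cases) (auto simp: Lambda_def)
  have v: "v \<in> words n" "i \<le> n" "rat u < \<alpha>" "\<alpha> \<le> rat v"
    using assms(1) by (auto simp: Lambda_def u)
  then show "rat u < \<alpha>" by simp
  show "rmin * \<alpha> \<le> rat u"
    using v rmin assms(2) mult_mono[of \<alpha> "rat v" rmin "r i"] by (simp add: u mult.commute)
  show "0 < rat u" using assms(1) by (auto simp: Lambda_def)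
qed

lemma finite_words_rat_ge:
  assumes "0 < \<delta>"
  shows "finite {u \<in> words n. \<delta> \<le> rat u}"
proof -
  obtain m where m: "rmax ^ m < \<delta>"
    using real_arch_pow_inv[OF assms rmax(2)] by blast
  have "length u \<le> m" if "u \<in> words n" "\<delta> \<le> rat u" for u
  proof (rule ccontr)
    assume "\<not> length u \<le> m"
    then have "rmax ^ length u \<le> rmax ^ m"
      using rmax by (intro power_decreasing) auto
    then show False using rat_le_rmax[OF that(1)] that(2) m by linarith
  qed
  then have "{u \<in> words n. \<delta> \<le> rat u} \<subseteq> {u. set u \<subseteq> {0..n} \<and> length u \<le> m}"
    by (auto simp: words_def)
  then show ?thesis
    by (rule finite_subset) (rule finite_lists_length_le, simp)
qed

lemma finite_Lambda: "0 < \<alpha> \<Longrightarrow> finite (Lambda n r \<alpha>)"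
  by (rule finite_subset[OF _ finite_words_rat_ge[of "rmin * \<alpha>"]])
    (use Lambda_rat Lambda_words rmin in auto)

text \<open>Words of one level are prefix-free: a proper extension would have a parent of ratio at
  most \<open>rat u\<close>, which is already below \<alpha>.\<close>

lemma Lambda_prefix_eq:
  assumes "u \<in> Lambda n r \<alpha>" "u @ v \<in> Lambda n r \<alpha>"
  shows "v = []"
proof (rule ccontr)
  assume "v \<noteq> []"
  then obtain v' i where v: "v = v' @ [i]" by (cases v rule: rev_cases) auto
  have "\<alpha> \<le> rat u * rat v'" "rat u < \<alpha>" "u \<in> words n" "v' \<in> words n"
    using assms by (auto simp: Lambda_def v butlast_append simp flip: append_assoc)
  moreover have "rat u * rat v' \<le> rat u * 1"
    using calculation by (intro mult_left_mono rat_le_1) (auto intro: less_imp_le)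
  ultimately show False by simp
qed

lemma Lambda_append:
  assumes "u \<in> words n" "v \<in> Lambda n r \<alpha>"
  shows "u @ v \<in> Lambda n r (rat u * \<alpha>)"
  using assms by (auto simp: Lambda_def butlast_append)

text \<open>Descend through child cells containing \<open>x\<close> and stop when the ratio first
  drops below \<alpha>. The geometric decay \<open>rmax ^ m\<close> bounds the number of steps and
  drives the induction.\<close>

lemma Lambda_extension:
  assumes "u \<in> words n" "x \<in> cell u" "0 < \<alpha>" "\<alpha> \<le> rat u"
  shows "\<exists>v. v \<noteq> [] \<and> u @ v \<in> Lambda n r \<alpha> \<and> x \<in> cell (u @ v)"
proof -
  obtain m where m: "rmax ^ m < \<alpha>"
    using real_arch_pow_inv[OF assms(3) rmax(2)] by blast
  have "rat u * rmax ^ m \<le> 1 * rmax ^ m"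
    using rat_le_1[OF assms(1)] rmax by (intro mult_right_mono) auto
  then have "rat u * rmax ^ m < \<alpha>" using m by simp
  with assms show ?thesis
  proof (induction m arbitrary: u)
    case 0
    then show ?case by simp
  next
    case (Suc m)
    obtain i where i: "i \<le> n" "x \<in> cell (u @ [i])"
      using cell_snoc Suc.prems by blast
    show ?case
    proof (cases "rat (u @ [i]) < \<alpha>")
      case True
      then have "u @ [i] \<in> Lambda n r \<alpha>" using Suc.prems i by (auto simp: Lambda_def)
      then show ?thesis using i by blast
    next
      case False
      have "rat u * r i * rmax ^ m \<le> rat u * rmax * rmax ^ m"
        using rmax i Suc.prems(1) by (intro mult_right_mono mult_left_mono) (auto intro: less_imp_le)
      also have "\<dots> < \<alpha>" using Suc.prems by (simp add: mult.assoc)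
      finally have "rat (u @ [i]) * rmax ^ m < \<alpha>" by simp
      then obtain v where "v \<noteq> []" "(u @ [i]) @ v \<in> Lambda n r \<alpha>" "x \<in> cell ((u @ [i]) @ v)"
        using Suc.IH[of "u @ [i]"] False i Suc.prems by auto
      then show ?thesis by (intro exI[of _ "[i] @ v"]) auto
    qed
  qed
qed


lemma norm_le_of_components:
  fixes x :: "real ^ 'd"
  assumes "\<And>k. \<bar>x $ k\<bar> \<le> b"
  shows "norm x \<le> real CARD('d) * b"
proof -
  have "norm x \<le> (\<Sum>k\<in>UNIV. \<bar>x $ k\<bar>)" by (rule norm_le_l1_cart)
  also have "\<dots> \<le> (\<Sum>k\<in>(UNIV :: 'd set). b)" using assms by (intro sum_mono)
  finally show ?thesis by simp
qed

subsection \<open>Consequences of the weak separation condition\<close>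

lemma S_lipschitz:
  assumes "i \<le> n"
  shows "dist (S i x) (S i y) \<le> r i * dist x y"
proof -
  have "A i \<in> cube_isometries" using orth fixes_cube assms by (simp add: cube_isometries_def)
  then show ?thesis
    using norm_cube_isometry[of "A i" "x - y"] ratio[OF assms]
    by (simp add: S assms dist_norm matrix_vector_mult_diff_distrib flip: scaleR_diff_right)
qed

text \<open>A common fixed point would be an attractor by itself, against uniqueness. The lemma
  supplies a second base point for weak separation, distinct from \<open>x0\<close>.\<close>

lemma moved_point: "\<exists>i\<le>n. S i x \<noteq> x"
proof (rule ccontr)
  assume "\<not> ?thesis"
  then have "is_attractor n S {x}" by (auto simp: is_attractor_def)
  then have "unit_cube \<subseteq> {x}"
    using is_attractor_subset[of n r S unit_cube "{x}"] S_lipschitz ratio attr by (meson less_imp_le)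
  moreover have "(0 :: real ^ 'd) \<in> unit_cube" "((\<chi> k. 1/2) :: real ^ 'd) \<in> unit_cube"
    by (simp_all add: mem_unit_cube)
  ultimately have "(0 :: real ^ 'd) = (\<chi> k. 1/2)" by blast
  then show False by (simp add: vec_eq_iff)
qed

text \<open>A ball of radius \<open>R * \<alpha>\<close> is covered by a number of balls of radius
  \<alpha> that depends only on \<open>R\<close>.\<close>

lemma wsc_images_bounded:
  assumes "\<And>\<alpha> c. 0 < \<alpha> \<Longrightarrow> finite ((\<lambda>\<sigma>. word_map S \<sigma> y) ` Lambda n r \<alpha> \<inter> cball c \<alpha>) \<and>
      card ((\<lambda>\<sigma>. word_map S \<sigma> y) ` Lambda n r \<alpha> \<inter> cball c \<alpha>) \<le> N"
  shows "\<exists>N'. \<forall>\<alpha>>0. \<forall>c. card ((\<lambda>\<sigma>. word_map S \<sigma> y) ` Lambda n r \<alpha> \<inter> cball c (R * \<alpha>)) \<le> N'"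
proof -
  obtain X where X: "finite X" "cball (0 :: real ^ 'd) R \<subseteq> (\<Union>x\<in>X. ball x 1)"
    using compact_cball[of "0 :: real ^ 'd" R] unfolding compact_eq_totally_bounded
    by (meson zero_less_one)
  show ?thesis
  proof (intro exI[of _ "card X * N"] allI impI)
    fix \<alpha> :: real and c :: "real ^ 'd" assume \<alpha>: "0 < \<alpha>"
    let ?P = "(\<lambda>\<sigma>. word_map S \<sigma> y) ` Lambda n r \<alpha>"
    have "?P \<inter> cball c (R * \<alpha>) \<subseteq> (\<Union>x\<in>X. ?P \<inter> cball (c + \<alpha> *\<^sub>R x) \<alpha>)"
    proof
      fix p assume p: "p \<in> ?P \<inter> cball c (R * \<alpha>)"
      have "norm ((1 / \<alpha>) *\<^sub>R (p - c)) \<le> R"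
        using p \<alpha> by (simp add: dist_norm norm_minus_commute divide_le_eq)
      then have "(1 / \<alpha>) *\<^sub>R (p - c) \<in> (\<Union>x\<in>X. ball x 1)"
        using X(2) unfolding mem_cball_0[symmetric] by blast
      then obtain x where x: "x \<in> X" "norm ((1 / \<alpha>) *\<^sub>R (p - c) - x) < 1"
        by (auto simp: dist_norm norm_minus_commute)
      have "p - (c + \<alpha> *\<^sub>R x) = \<alpha> *\<^sub>R ((1 / \<alpha>) *\<^sub>R (p - c) - x)"
        using \<alpha> by (simp add: scaleR_diff_right)
      then have "norm (p - (c + \<alpha> *\<^sub>R x)) \<le> \<alpha>" using x(2) \<alpha> by simp
      then show "p \<in> (\<Union>x\<in>X. ?P \<inter> cball (c + \<alpha> *\<^sub>R x) \<alpha>)"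
        using p x(1) by (auto simp: dist_norm norm_minus_commute intro!: bexI[of _ x])
    qed
    then have "card (?P \<inter> cball c (R * \<alpha>)) \<le> card (\<Union>x\<in>X. ?P \<inter> cball (c + \<alpha> *\<^sub>R x) \<alpha>)"
      using X(1) \<alpha> by (intro card_mono finite_UN_I finite_Int) (auto simp: finite_Lambda)
    also have "\<dots> \<le> (\<Sum>x\<in>X. card (?P \<inter> cball (c + \<alpha> *\<^sub>R x) \<alpha>))"
      by (rule card_UN_le[OF X(1)])
    also have "\<dots> \<le> (\<Sum>x\<in>X. N)" using assms[OF \<alpha>] by (intro sum_mono) blast
    finally show "card (?P \<inter> cball c (R * \<alpha>)) \<le> card X * N" by simp
  qed
qed

text \<open>A cell is determined by the linear part of its map, which takes finitely many values,
  and the images of two distinct points.\<close>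

lemma nearby_cells_bounded:
  "\<exists>Q. \<forall>\<alpha>>0. \<forall>x. card ((\<lambda>u. (centre u, rat u)) ` {u \<in> Lambda n r \<alpha>. norm (centre u - x) \<le> R * \<alpha>}) \<le> Q"
proof -
  obtain x0 N where wsc': "\<And>\<alpha> \<tau> c. 0 < \<alpha> \<Longrightarrow> \<tau> \<in> words n \<Longrightarrow>
      finite ((\<lambda>\<sigma>. word_map S \<sigma> (word_map S \<tau> x0)) ` Lambda n r \<alpha> \<inter> cball c \<alpha>) \<and>
      card ((\<lambda>\<sigma>. word_map S \<sigma> (word_map S \<tau> x0)) ` Lambda n r \<alpha> \<inter> cball c \<alpha>) \<le> N"
    using wsc unfolding weak_separation_def Let_def by metis
  obtain i where i: "i \<le> n" "S i x0 \<noteq> x0" using moved_point by blast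
  \<comment> \<open>The point \<open>y\<close> is covered by the separation condition too, through
    the word \<tau> = \<open>[i]\<close>.\<close>
  define y where "y = S i x0"
  obtain N1 where N1: "\<And>\<alpha> c. 0 < \<alpha> \<Longrightarrow>
      card ((\<lambda>\<sigma>. word_map S \<sigma> x0) ` Lambda n r \<alpha> \<inter> cball c ((R + norm x0) * \<alpha>)) \<le> N1"
    using wsc_images_bounded[of x0 N "R + norm x0"] wsc'[of _ "[]"] by simp metis
  obtain N2 where N2: "\<And>\<alpha> c. 0 < \<alpha> \<Longrightarrow>
      card ((\<lambda>\<sigma>. word_map S \<sigma> y) ` Lambda n r \<alpha> \<inter> cball c ((R + norm y) * \<alpha>)) \<le> N2"
    using wsc_images_bounded[of y N "R + norm y"] wsc'[of _ "[i]"] i by (simp add: y_def) metis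
  define G where "G = (cube_isometries :: (real ^ 'd ^ 'd) set)"
  show ?thesis
  proof (intro exI[of _ "card G * (N1 * N2)"] allI impI)
    fix \<alpha> :: real and x :: "real ^ 'd" assume \<alpha>: "0 < \<alpha>"
    let ?P1 = "(\<lambda>\<sigma>. word_map S \<sigma> x0) ` Lambda n r \<alpha> \<inter> cball x ((R + norm x0) * \<alpha>)"
    let ?P2 = "(\<lambda>\<sigma>. word_map S \<sigma> y) ` Lambda n r \<alpha> \<inter> cball x ((R + norm y) * \<alpha>)"
    let ?C = "(\<lambda>u. (centre u, rat u)) ` {u \<in> Lambda n r \<alpha>. norm (centre u - x) \<le> R * \<alpha>}"
    \<comment> \<open>\<open>f\<close> recovers the code of a cell: the ratio is a quotient of
      distances, and the centre is the image of \<open>x0\<close> minus the scaled linear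
      part.\<close>
    define f where "f = (\<lambda>(M :: real ^ 'd ^ 'd, a, b). (a - (norm (a - b) / norm (x0 - y)) *\<^sub>R (M *v x0),
      norm (a - b) / norm (x0 - y)))"
    have fin: "finite (G \<times> ?P1 \<times> ?P2)"
      using finite_cube_isometries finite_Lambda[OF \<alpha>] by (auto simp: G_def)
    have "?C \<subseteq> f ` (G \<times> ?P1 \<times> ?P2)"
    proof
      fix p assume "p \<in> ?C"
      then obtain u where u: "p = (centre u, rat u)" "u \<in> Lambda n r \<alpha>" "norm (centre u - x) \<le> R * \<alpha>"
        by auto
      note w = Lambda_words[OF u(2)]
      have in_ball: "word_map S u z \<in> cball x ((R + norm z) * \<alpha>)" for z
      proof -
        have "norm (word_map S u z - x) \<le> norm (rat u *\<^sub>R (lin u *v z)) + norm (centre u - x)"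
          using norm_triangle_ineq[of "rat u *\<^sub>R (lin u *v z)" "centre u - x"]
          by (simp add: word_map_eq[OF w] algebra_simps)
        also have "norm (rat u *\<^sub>R (lin u *v z)) \<le> \<alpha> * norm z"
          using Lambda_rat[OF u(2) \<alpha>] norm_cube_isometry[OF lin_in[OF w], of z]
          by (simp add: mult_right_mono)
        finally show ?thesis using u(3) by (simp add: dist_norm norm_minus_commute algebra_simps)
      qed
      have "word_map S u x0 - word_map S u y = rat u *\<^sub>R (lin u *v (x0 - y))"
        by (simp add: word_map_eq[OF w] matrix_vector_mult_diff_distrib scaleR_diff_right)
      then have "norm (word_map S u x0 - word_map S u y) = rat u * norm (x0 - y)"
        using rat_pos[OF w] norm_cube_isometry[OF lin_in[OF w], of "x0 - y"] by simp
      then have "norm (word_map S u x0 - word_map S u y) / norm (x0 - y) = rat u"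
        using i by (simp add: y_def)
      then have "p = f (lin u, word_map S u x0, word_map S u y)"
        by (simp add: f_def u(1) word_map_eq[OF w])
      moreover have "(lin u, word_map S u x0, word_map S u y) \<in> G \<times> ?P1 \<times> ?P2"
        using in_ball u(2) lin_in[OF w] by (auto simp: G_def)
      ultimately show "p \<in> f ` (G \<times> ?P1 \<times> ?P2)" by blast
    qed
    then have "card ?C \<le> card (G \<times> ?P1 \<times> ?P2)"
      using surj_card_le[OF fin] by blast
    also have "\<dots> = card G * (card ?P1 * card ?P2)" by (simp add: card_cartesian_product)
    also have "\<dots> \<le> card G * (N1 * N2)" by (intro mult_le_mono le_refl N1 N2 \<alpha>)
    finally show "card ?C \<le> card G * (N1 * N2)" .
  qed
qed

text \<open>A pair \<open>(x, \<alpha>)\<close> maximising the number of cells of level \<open>\<alpha>\<close> through \<open>x\<close>: no further cell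
  can pass through the image of \<open>x\<close> under any \<open>S\<^sub>u\<close> at the corresponding level.\<close>

lemma saturated_point:
  "\<exists>x \<alpha>. x \<in> unit_cube \<and> 0 < \<alpha> \<and>
     (\<forall>u\<in>words n. \<forall>v\<in>Lambda n r (rat u * \<alpha>). word_map S u x \<in> cell v \<longrightarrow>
        (\<exists>w\<in>Lambda n r \<alpha>. centre v = centre (u @ w) \<and> rat v = rat (u @ w)))"
proof -
  define code where "code = (\<lambda>u. (centre u, rat u))"
  define through where "through = (\<lambda>(x, \<alpha>). {u \<in> Lambda n r \<alpha>. x \<in> cell u})"
  obtain Q where "\<forall>\<alpha>>0. \<forall>x. card ((\<lambda>u. (centre u, rat u)) `
      {u \<in> Lambda n r \<alpha>. norm (centre u - x) \<le> real CARD('d) * \<alpha>}) \<le> Q"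
    using nearby_cells_bounded[of "real CARD('d)"] ..
  then have Q: "card (code ` {u \<in> Lambda n r \<alpha>. norm (centre u - x) \<le> real CARD('d) * \<alpha>}) \<le> Q"
    if "0 < \<alpha>" for \<alpha> x
    unfolding code_def using that by simp
  have fin: "finite (through (x, \<alpha>))" if "0 < \<alpha>" for x \<alpha>
    using finite_Lambda[OF that] by (simp add: through_def)
  have bound: "card (code ` through p) \<le> Q" if "0 < snd p" for p
  proof -
    obtain x \<alpha> where "p = (x, \<alpha>)" by fastforce
    with that have p: "p = (x, \<alpha>)" "0 < \<alpha>" by simp_all
    have "norm (centre u - x) \<le> CARD('d) * \<alpha>" if "u \<in> through p" for u
    proof (rule norm_le_of_components)
      fix k
      have "x \<in> cell u" "rat u < \<alpha>" using that Lambda_rat p(2) by (auto simp: through_def p)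
      then have "lo u k \<le> x $ k" "x $ k \<le> hi u k" by (auto simp: cell_def)
      with \<open>rat u < \<alpha>\<close> p(2) show "\<bar>(centre u - x) $ k\<bar> \<le> \<alpha>"
        unfolding lo_def hi_def vector_minus_component by linarith
    qed
    then have "code ` through p \<subseteq> code ` {u \<in> Lambda n r \<alpha>. norm (centre u - x) \<le> CARD('d) * \<alpha>}"
      by (auto simp: through_def p)
    then have "card (code ` through p) \<le> card (code ` {u \<in> Lambda n r \<alpha>. norm (centre u - x) \<le> CARD('d) * \<alpha>})"
      using finite_Lambda[OF p(2)] by (intro card_mono) auto
    then show ?thesis using Q[OF p(2)] by (rule order_trans)
  qed
  have "\<exists>p. 0 < snd p \<and> (\<forall>q. 0 < snd q \<longrightarrow> card (code ` through q) \<le> card (code ` through p))"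
    by (rule ex_has_greatest_nat[of _ "(0, 1)" _ "Suc Q"]) (use bound in \<open>auto simp: less_Suc_eq_le\<close>)
  then obtain p where p: "0 < snd p" "\<And>q. 0 < snd q \<Longrightarrow> card (code ` through q) \<le> card (code ` through p)"
    by blast
  obtain x \<alpha> where xa: "p = (x, \<alpha>)" by fastforce
  have \<alpha>: "0 < \<alpha>" using p(1) xa by simp
  \<comment> \<open>Some cell of level 1 contains the origin, so the maximal count is positive and
    \<open>x\<close> lies in a cell, hence in the cube.\<close>
  have "(0 :: real ^ 'd) \<in> cell []" by (simp add: cell_def lo_def hi_def)
  then obtain v where "v \<in> Lambda n r 1" "0 \<in> cell v"
    using Lambda_extension[of "[]" 0 1] by auto
  then have "through (0, 1) \<noteq> {}" by (auto simp: through_def)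
  then have "0 < card (code ` through (0, 1))" using fin[of 1 0] by (simp add: card_gt_0_iff)
  also have "\<dots> \<le> card (code ` through p)" using p(2) by simp
  finally have "through p \<noteq> {}" by auto
  then obtain w where "w \<in> words n" "x \<in> cell w"
    using Lambda_words by (auto simp: through_def xa)
  then have "x \<in> unit_cube"
    using word_map_unit_cube by (auto simp: image_cell[symmetric])
  moreover have "\<exists>w\<in>Lambda n r \<alpha>. centre v = centre (u @ w) \<and> rat v = rat (u @ w)"
    if u: "u \<in> words n" and v: "v \<in> Lambda n r (rat u * \<alpha>)" "word_map S u x \<in> cell v" for u v
  proof -
    define q where "q = (word_map S u x, rat u * \<alpha>)"
    \<comment> \<open>\<open>g\<close> is the action of the map of \<open>u\<close> on codes. It
      injects the codes at \<open>p\<close> into those at \<open>q\<close>; maximality of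
      \<open>p\<close> makes this injection onto.\<close>
    define g where "g = (\<lambda>(c, \<rho>). (rat u *\<^sub>R (lin u *v c) + centre u, rat u * \<rho> :: real))"
    have q: "0 < snd q" using \<alpha> rat_pos[OF u] by (simp add: q_def)
    have finq: "finite (code ` through q)" using fin q by (simp add: q_def)
    have g: "g (code w) = code (u @ w)" if "w \<in> words n" for w
      using that u by (simp add: g_def code_def centre_append)
    have "inj g"
    proof (rule injI)
      fix a b assume "g a = g b"
      moreover obtain c \<rho> c' \<rho>' where ab: "a = (c, \<rho>)" "b = (c', \<rho>')" by fastforce
      ultimately have "lin u *v c = lin u *v c'" "\<rho> = \<rho>'"
        using rat_pos[OF u] by (auto simp: g_def)
      then have "lin u *v (c - c') = 0" by (simp add: matrix_vector_mult_diff_distrib)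
      then have "c = c'" using norm_cube_isometry[OF lin_in[OF u], of "c - c'"] by simp
      then show "a = b" using \<open>\<rho> = \<rho>'\<close> ab by simp
    qed
    have sub: "g ` code ` through p \<subseteq> code ` through q"
    proof
      fix z assume "z \<in> g ` code ` through p"
      then obtain w where w: "w \<in> Lambda n r \<alpha>" "x \<in> cell w" "z = g (code w)"
        by (auto simp: through_def xa)
      note ww = Lambda_words[OF w(1)]
      obtain y where y: "y \<in> unit_cube" "x = word_map S w y"
        using w(2) image_cell[OF ww] by blast
      have "word_map S u x \<in> cell (u @ w)"
        using y u ww by (auto simp: image_cell[symmetric] word_map_append)
      then have "u @ w \<in> through q"
        using Lambda_append[OF u w(1)] by (simp add: through_def q_def)
      then show "z \<in> code ` through q" using g[OF ww] w(3) by simp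
    qed
    have "card (code ` through q) \<le> card (g ` code ` through p)"
      using p(2)[OF q] card_image[OF inj_on_subset[OF \<open>inj g\<close> subset_UNIV]] by metis
    then have "g ` code ` through p = code ` through q"
      using card_seteq[OF finq sub] by blast
    moreover have "code v \<in> code ` through q"
      using v by (auto simp: through_def q_def)
    ultimately obtain w where "w \<in> through p" "code v = g (code w)" by (smt (verit) imageE)
    then have "w \<in> Lambda n r \<alpha>" "code v = code (u @ w)"
      using g Lambda_words by (auto simp: through_def xa)
    then show ?thesis by (auto simp: code_def)
  qed
  ultimately show ?thesis using \<alpha> by blast
qed


subsection \<open>Finiteness of relative positions\<close>

text \<open>A small cell \<open>u @ p\<close> at the middle of the overlap carries a copy
  \<open>z'\<close> of the saturated point, which also lies in \<open>cell v\<close>. Saturation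
  identifies a subcell \<open>v @ q\<close> through \<open>z'\<close> with some
  \<open>u @ p @ w\<close>. So the relative position is a function of \<open>p @ w\<close>,
  \<open>q\<close> and two linear parts, all from finite sets.\<close>

lemma finite_rel:
  assumes "0 < c"
  shows "finite {rel u v |u v. \<exists>\<alpha>>0. u \<in> Lambda n r \<alpha> \<and> v \<in> Lambda n r \<alpha> \<and> (\<forall>k. c * \<alpha> \<le> width u v k)}"
    (is "finite ?Z")
proof -
  obtain x \<alpha>' where x: "x \<in> unit_cube" and \<alpha>': "0 < \<alpha>'"
    and sat: "\<And>u v. u \<in> words n \<Longrightarrow> v \<in> Lambda n r (rat u * \<alpha>') \<Longrightarrow> word_map S u x \<in> cell v \<Longrightarrow>
        \<exists>w\<in>Lambda n r \<alpha>'. centre v = centre (u @ w) \<and> rat v = rat (u @ w)"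
    using saturated_point by blast
  \<comment> \<open>The three bounds allow a descent from the empty word to level \<gamma>, keep
    \<open>cell (u @ p)\<close> near the middle of the overlap, and keep \<beta> at most
    \<open>rat v\<close> so that \<open>v\<close> can be extended.\<close>
  define \<gamma> where "\<gamma> = min 1 (min (c / 2) (rmin / \<alpha>'))"
  have "\<gamma> \<le> c / 2" unfolding \<gamma>_def by (intro min.coboundedI2 min.cobounded1)
  then have \<gamma>: "0 < \<gamma>" "\<gamma> \<le> 1" "\<gamma> \<le> c / 2" "\<gamma> * \<alpha>' \<le> rmin"
  proof -
    have "\<gamma> \<le> rmin / \<alpha>'" by (simp add: \<gamma>_def)
    then show "\<gamma> * \<alpha>' \<le> rmin" using \<alpha>' by (simp add: pos_le_divide_eq)
  qed (use assms rmin(1) \<alpha>' in \<open>simp_all add: \<gamma>_def\<close>)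
  \<comment> \<open>A lower bound for \<open>rat q\<close>, which confines \<open>q\<close> to a
    finite set of words.\<close>
  define \<delta> where "\<delta> = rmin * rmin * (rmin * \<gamma>) * \<alpha>'"
  have \<delta>: "0 < \<delta>" using rmin \<gamma> \<alpha>' by (simp add: \<delta>_def)
  define G where "G = (cube_isometries :: (real ^ 'd ^ 'd) set)"
  define h where "h = (\<lambda>(M, M', u, v). (rat u / rat v,
      M *v centre u - (rat u / rat v) *\<^sub>R (M' *v centre v)) :: real \<times> (real ^ 'd))"
  define L where "L = (\<lambda>(u, v). u @ v) ` (Lambda n r \<gamma> \<times> Lambda n r \<alpha>')"
  have "finite (G \<times> G \<times> L \<times> {u \<in> words n. \<delta> \<le> rat u})"
    using finite_cube_isometries finite_Lambda \<gamma>(1) \<alpha>' finite_words_rat_ge[OF \<delta>]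
    by (auto simp: G_def L_def)
  moreover have "?Z \<subseteq> h ` (G \<times> G \<times> L \<times> {u \<in> words n. \<delta> \<le> rat u})"
  proof
    fix z assume "z \<in> ?Z"
    then obtain u v \<alpha> where z: "z = rel u v" and \<alpha>: "0 < \<alpha>"
      and u: "u \<in> Lambda n r \<alpha>" and v: "v \<in> Lambda n r \<alpha>" and width: "\<And>k. c * \<alpha> \<le> width u v k"
      by blast
    note uw = Lambda_words[OF u] and vw = Lambda_words[OF v]
    note ur = Lambda_rat[OF u \<alpha>] and vr = Lambda_rat[OF v \<alpha>]
    have ca: "0 < c * \<alpha>" using assms \<alpha> by simp
    define y :: "real ^ 'd" where "y = (\<chi> k. (max (lo u k) (lo v k) + min (hi u k) (hi v k)) / 2)"
    have y: "max (lo u k) (lo v k) \<le> y $ k - c * \<alpha> / 2" "y $ k + c * \<alpha> / 2 \<le> min (hi u k) (hi v k)" for k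
      using width[of k] by (auto simp: y_def width_def field_simps)
    have "y \<in> cell u"
      unfolding cell_def
    proof (intro CollectI allI)
      fix k show "lo u k \<le> y $ k \<and> y $ k \<le> hi u k" using y[of k] ca by linarith
    qed
    then obtain y' where y': "y' \<in> unit_cube" "y = word_map S u y'"
      using image_cell[OF uw] by blast
    have "y' \<in> cell []" using y'(1) image_cell[of "[]"] by simp
    then obtain p where p: "p \<in> Lambda n r \<gamma>" "y' \<in> cell p"
      using Lambda_extension[of "[]" y' \<gamma>] \<gamma> by auto
    note pw = Lambda_words[OF p(1)] and pr = Lambda_rat[OF p(1) \<gamma>(1)]
    define z' where "z' = word_map S (u @ p) x"
    have "y \<in> cell (u @ p)"
      using p(2) uw pw y'(2) by (auto simp: image_cell[symmetric] word_map_append)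
    moreover have "z' \<in> cell (u @ p)"
      using x uw pw by (auto simp: image_cell[symmetric] z'_def)
    moreover have "rat (u @ p) \<le> c * \<alpha> / 2"
      using mult_mono[of "rat u" \<alpha> "rat p" "c / 2"] ur pr \<gamma> \<alpha> by (simp add: mult.commute)
    ultimately have near: "\<bar>z' $ k - y $ k\<bar> \<le> c * \<alpha> / 2" for k
    proof -
      assume in_cell: "y \<in> cell (u @ p)" "z' \<in> cell (u @ p)" and rat: "rat (u @ p) \<le> c * \<alpha> / 2"
      have "lo (u @ p) k \<le> y $ k" "y $ k \<le> hi (u @ p) k" "lo (u @ p) k \<le> z' $ k" "z' $ k \<le> hi (u @ p) k"
        using in_cell by (auto simp: cell_def)
      then show ?thesis using rat unfolding lo_def hi_def by linarith
    qed
    have "z' \<in> cell v"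
      unfolding cell_def
    proof (intro CollectI allI)
      fix k show "lo v k \<le> z' $ k \<and> z' $ k \<le> hi v k" using near[of k] y[of k] by linarith
    qed
    define \<beta> where "\<beta> = rat (u @ p) * \<alpha>'"
    have \<beta>: "0 < \<beta>" using uw pw \<alpha>' by (simp add: \<beta>_def)
    have "rat p * \<alpha>' \<le> rmin" using pr \<gamma>(4) \<alpha>' mult_right_mono[of "rat p" \<gamma> \<alpha>'] by linarith
    then have "\<beta> \<le> \<alpha> * rmin"
      using mult_mono[of "rat u" \<alpha> "rat p * \<alpha>'" rmin] ur pr \<alpha> \<alpha>' by (simp add: \<beta>_def mult.assoc)
    then have "\<beta> \<le> rat v" using vr by (simp add: mult.commute)
    then obtain q where q: "v @ q \<in> Lambda n r \<beta>" "z' \<in> cell (v @ q)"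
      using Lambda_extension[OF vw \<open>z' \<in> cell v\<close> \<beta>] by blast
    have qw: "q \<in> words n" using Lambda_words[OF q(1)] by simp
    obtain w where w: "w \<in> Lambda n r \<alpha>'" "centre (v @ q) = centre (u @ p @ w)" "rat (v @ q) = rat (u @ p @ w)"
      using sat[of "u @ p" "v @ q"] q uw pw unfolding \<beta>_def z'_def by auto
    have pww: "p @ w \<in> words n" using pw Lambda_words[OF w(1)] by simp
    have c_eq: "rat v *\<^sub>R (lin v *v centre q) + centre v = rat u *\<^sub>R (lin u *v centre (p @ w)) + centre u"
      using w(2) centre_append[OF vw qw] centre_append[OF uw pww] by simp
    have r_eq: "rat v * rat q = rat u * rat (p @ w)" using w(3) by simp
    have pos: "0 < rat u" "0 < rat v" "0 < rat q" using uw vw qw by auto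
    have r_div: "rat v / rat u = rat (p @ w) / rat q"
      using r_eq pos by (simp add: field_simps)
    have "centre v - centre u = rat u *\<^sub>R (lin u *v centre (p @ w)) - rat v *\<^sub>R (lin v *v centre q)"
    proof -
      have "a - b = y - x" if "x + a = y + b" for a b x y :: "real ^ 'd"
      proof -
        have "a = y + b - x" unfolding that[symmetric] by simp
        then show ?thesis by simp
      qed
      then show ?thesis using c_eq by blast
    qed
    then have "(1 / rat u) *\<^sub>R (centre v - centre u)
        = lin u *v centre (p @ w) - (rat v / rat u) *\<^sub>R (lin v *v centre q)"
      using pos by (simp add: scaleR_diff_right)
    then have "z = h (lin u, lin v, p @ w, q)"
      by (simp add: z rel_def h_def r_div)
    moreover have "\<delta> \<le> rat q"
    proof -
      have "rmin * (rmin * \<alpha> * (rmin * \<gamma>) * \<alpha>') \<le> rmin * \<beta>"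
        unfolding \<beta>_def rat_append using ur pr rmin \<alpha> \<alpha>' \<gamma>
        by (intro mult_left_mono mult_right_mono mult_mono) auto
      also have "\<dots> \<le> rat v * rat q" using Lambda_rat[OF q(1) \<beta>] by simp
      also have "\<dots> \<le> \<alpha> * rat q" using vr pos by (intro mult_right_mono) auto
      finally have "\<alpha> * \<delta> \<le> \<alpha> * rat q" by (simp add: \<delta>_def mult_ac)
      then show ?thesis using \<alpha> by simp
    qed
    moreover have "p @ w \<in> L" using p(1) w(1) by (force simp: L_def)
    ultimately show "z \<in> h ` (G \<times> G \<times> L \<times> {u \<in> words n. \<delta> \<le> rat u})"
      using lin_in[OF uw] lin_in[OF vw] qw by (auto simp: G_def)
  qed
  ultimately show ?thesis by (meson finite_imageI finite_subset)
qed

text \<open>The ratio and the translation of the common prefix cancel; only its linear part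
  survives.\<close>

lemma finite_rel_siblings: "finite {rel (w @ [i]) (w @ [j]) |w i j. w \<in> words n \<and> i \<le> n \<and> j \<le> n}"
    (is "finite ?Z")
proof -
  define h where "h = (\<lambda>(M, i, j). (r j / r i, (1 / r i) *\<^sub>R (M *v (t j - t i))) :: real \<times> (real ^ 'd))"
  have "?Z \<subseteq> h ` (cube_isometries \<times> {0..n} \<times> {0..n})"
  proof
    fix z assume "z \<in> ?Z"
    then obtain w i j where z: "z = rel (w @ [i]) (w @ [j])" "w \<in> words n" "i \<le> n" "j \<le> n" by blast
    have "centre (w @ [i]) = rat w *\<^sub>R (lin w *v t i) + centre w" if "i \<le> n" for i
      using that centre_append[OF z(2), of "[i]"] by simp
    then have "z = h (lin w, i, j)"
      using z rat_pos[OF z(2)]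
      by (simp add: rel_def h_def matrix_vector_mult_diff_distrib flip: scaleR_diff_right)
    then show "z \<in> h ` (cube_isometries \<times> {0..n} \<times> {0..n})"
      using z lin_in by auto
  qed
  then show ?thesis
    using finite_cube_isometries by (meson finite_SigmaI finite_atLeastAtMost finite_imageI finite_subset)
qed

text \<open>Relative positions compose like the affine maps given by scaling and translation. This
  controls two cells with a tiny overlap through a third one that overlaps both widely.\<close>

lemma rel_trans:
  assumes "u \<in> words n" "v \<in> words n"
  shows "rel u w = (fst (rel u v) * fst (rel v w), snd (rel u v) + fst (rel u v) *\<^sub>R snd (rel v w))"
  using rat_pos[OF assms(1)] rat_pos[OF assms(2)]
  by (simp add: rel_def flip: scaleR_add_right)

text \<open>Divided by \<open>rat u\<close>, the width and the face differences are functions of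
  \<open>rel u v\<close> alone, so over a finite set their nonzero values stay away from 0. Passing
  from \<open>rat u\<close> to \<alpha> costs the factor \<open>rmin\<close>.\<close>

lemma finite_rel_gap:
  assumes "finite Z"
  shows "\<exists>g>0. \<forall>\<alpha>>0. \<forall>u\<in>words n. \<forall>v. \<forall>k. rmin * \<alpha> \<le> rat u \<longrightarrow> rel u v \<in> Z \<longrightarrow>
    (width u v k \<noteq> 0 \<longrightarrow> g * \<alpha> \<le> \<bar>width u v k\<bar>) \<and>
    (lo v k \<noteq> lo u k \<longrightarrow> g * \<alpha> \<le> \<bar>lo v k - lo u k\<bar>) \<and>
    (hi v k \<noteq> hi u k \<longrightarrow> g * \<alpha> \<le> \<bar>hi v k - hi u k\<bar>)"
proof -
  define fw where "fw = (\<lambda>k (\<rho>, x :: real ^ 'd). min (1/2) (x $ k + \<rho>/2) - max (- 1/2) (x $ k - \<rho>/2))"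
  define fl where "fl = (\<lambda>k (\<rho>, x :: real ^ 'd). x $ k - \<rho>/2 + 1/2)"
  define fh where "fh = (\<lambda>k (\<rho>, x :: real ^ 'd). x $ k + \<rho>/2 - 1/2)"
  have "finite (\<Union>k. fw k ` Z \<union> fl k ` Z \<union> fh k ` Z)" using assms by simp
  then obtain g where g: "0 < g" "\<And>z. z \<in> (\<Union>k. fw k ` Z \<union> fl k ` Z \<union> fh k ` Z) \<Longrightarrow> z \<noteq> 0 \<Longrightarrow> g \<le> \<bar>z\<bar>"
    using finite_nonzero_bounded_below by meson
  show ?thesis
  proof (intro exI[of _ "g * rmin"] conjI[OF mult_pos_pos[OF g(1) rmin(1)]] allI ballI impI)
    fix \<alpha> :: real and u v k
    assume \<alpha>: "0 < \<alpha>" and u: "u \<in> words n" "rmin * \<alpha> \<le> rat u" "rel u v \<in> Z"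
    have pos: "0 < rat u" using u by simp
    have scale: "g * rmin * \<alpha> \<le> \<bar>rat u * z\<bar>" if "z \<in> fw k ` Z \<union> fl k ` Z \<union> fh k ` Z" "z \<noteq> 0" for z
    proof -
      have "g \<le> \<bar>z\<bar>" using g(2) that by blast
      then have "(rmin * \<alpha>) * g \<le> rat u * \<bar>z\<bar>"
        using u(2) g(1) pos by (intro mult_mono) auto
      then show ?thesis using pos by (simp add: abs_mult mult_ac)
    qed
    have cl: "centre v $ k = rat u * snd (rel u v) $ k + centre u $ k" "rat v = rat u * fst (rel u v)"
      using pos by (simp_all add: rel_def)
    have l: "lo v k - lo u k = rat u * fl k (rel u v)"
      using cl by (simp add: fl_def lo_def split_beta algebra_simps)
    have h: "hi v k - hi u k = rat u * fh k (rel u v)"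
      using cl by (simp add: fh_def hi_def split_beta algebra_simps)
    have "min (hi u k) (hi v k) - centre u $ k = rat u * min (1/2) (snd (rel u v) $ k + fst (rel u v)/2)"
      using pos cl by (simp add: hi_def min_mult_distrib_left min_diff_distrib_left algebra_simps)
    moreover have "max (lo u k) (lo v k) - centre u $ k = rat u * max (- 1/2) (snd (rel u v) $ k - fst (rel u v)/2)"
      using pos cl by (simp add: lo_def max_mult_distrib_left max_diff_distrib_left algebra_simps)
    ultimately have w: "width u v k = rat u * fw k (rel u v)"
      by (simp add: width_def fw_def split_beta right_diff_distrib)
    have "width u v k \<noteq> 0 \<Longrightarrow> g * rmin * \<alpha> \<le> \<bar>width u v k\<bar>"
      unfolding w using u(3) by (intro scale) auto
    moreover have "lo v k \<noteq> lo u k \<Longrightarrow> g * rmin * \<alpha> \<le> \<bar>lo v k - lo u k\<bar>"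
      unfolding l using u(3) l by (intro scale) auto
    moreover have "hi v k \<noteq> hi u k \<Longrightarrow> g * rmin * \<alpha> \<le> \<bar>hi v k - hi u k\<bar>"
      unfolding h using u(3) h by (intro scale) auto
    ultimately show "(width u v k \<noteq> 0 \<longrightarrow> g * rmin * \<alpha> \<le> \<bar>width u v k\<bar>) \<and>
        (lo v k \<noteq> lo u k \<longrightarrow> g * rmin * \<alpha> \<le> \<bar>lo v k - lo u k\<bar>) \<and>
        (hi v k \<noteq> hi u k \<longrightarrow> g * rmin * \<alpha> \<le> \<bar>hi v k - hi u k\<bar>)" by blast
  qed
qed

subsection \<open>Pairs of cells with the longest common prefix\<close>

lemma width_commute: "width u v k = width v u k"
  by (simp add: width_def min.commute max.commute)

lemma hi_minus_lo: "hi u k - lo u k = rat u"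
  by (simp add: hi_def lo_def)

text \<open>Equality is required only on \<open>T\<close>, where the overlap is tiny. Elsewhere
  containment suffices, so a cell can be replaced without control over where its faces lie outside
  \<open>[a, b]\<close>.\<close>

definition meets :: "'d set \<Rightarrow> ('d \<Rightarrow> real) \<Rightarrow> ('d \<Rightarrow> real) \<Rightarrow> nat list \<Rightarrow> nat list \<Rightarrow> bool" where
  "meets T a b u v \<longleftrightarrow>
     (\<forall>k\<in>T. max (lo u k) (lo v k) = a k \<and> min (hi u k) (hi v k) = b k) \<and>
     (\<forall>k. k \<notin> T \<longrightarrow> lo u k \<le> a k \<and> lo v k \<le> a k \<and> b k \<le> hi u k \<and> b k \<le> hi v k)"

lemma meets_commute: "meets T a b u v \<longleftrightarrow> meets T a b v u"
  by (auto simp: meets_def max.commute min.commute)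

lemma meets_bounds:
  assumes "meets T a b u v"
  shows "lo u k \<le> a k" "lo v k \<le> a k" "b k \<le> hi u k" "b k \<le> hi v k"
proof -
  have "lo u k \<le> a k \<and> lo v k \<le> a k \<and> b k \<le> hi u k \<and> b k \<le> hi v k"
  proof (cases "k \<in> T")
    case True
    then have "max (lo u k) (lo v k) = a k" "min (hi u k) (hi v k) = b k"
      using assms by (auto simp: meets_def)
    then show ?thesis by linarith
  qed (use assms in \<open>auto simp: meets_def\<close>)
  then show "lo u k \<le> a k" "lo v k \<le> a k" "b k \<le> hi u k" "b k \<le> hi v k" by auto
qed

text \<open>\<open>T\<close> is the set of coordinates in which the overlap \<open>[a, b]\<close> is tiny. In the other coordinates
  \<open>[a, b]\<close> is a part of the overlap that no face of a nearby cell cuts, so it stays in the overlap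
  however often a cell is replaced by another one. \<open>IH5\<close> and \<open>IH7\<close> are instances of the induction
  hypothesis, \<open>gap4\<close>, \<open>gap5\<close>, \<open>gap2\<close> and \<open>gap_sib\<close> of the discreteness of relative positions.\<close>

context
  fixes \<alpha> C E C4 C5 C6 C7 G2 G5 :: real and T :: "'d set" and a b :: "'d \<Rightarrow> real"
    and z :: "real ^ 'd" and m :: nat
  assumes \<alpha>: "0 < \<alpha>" and card_T: "card T \<le> Suc m"
    and ab: "\<And>k. a k < b k"
    and small: "\<And>k. k \<in> T \<Longrightarrow> b k - a k < E"
    and wide: "\<And>k. k \<notin> T \<Longrightarrow> C \<le> b k - a k"
    and E: "E \<le> rmin * \<alpha> / 4" "E \<le> G5" "E \<le> G2"
    and z: "\<And>k. \<bar>a k - z $ k\<bar> \<le> \<alpha>" "\<And>k. \<bar>b k - z $ k\<bar> \<le> \<alpha>"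
    and near: "\<And>u k. u \<in> Lambda n r \<alpha> \<Longrightarrow> norm (centre u - z) \<le> CARD('d) * (3 * \<alpha>) \<Longrightarrow> k \<notin> T \<Longrightarrow>
        lo u k \<notin> {a k<..<b k} \<and> hi u k \<notin> {a k<..<b k}"
    and C4: "C4 \<le> rmin * \<alpha> / 4"
    and gap4: "\<And>u v k. u \<in> Lambda n r \<alpha> \<Longrightarrow> v \<in> Lambda n r \<alpha> \<Longrightarrow>
        (\<And>k. min C (rmin * \<alpha> / 4) \<le> width u v k) \<Longrightarrow>
        (lo v k \<noteq> lo u k \<longrightarrow> C4 \<le> \<bar>lo v k - lo u k\<bar>) \<and> (hi v k \<noteq> hi u k \<longrightarrow> C4 \<le> \<bar>hi v k - hi u k\<bar>)"
    and IH5: "\<And>u v k. u \<in> Lambda n r \<alpha> \<Longrightarrow> v \<in> Lambda n r \<alpha> \<Longrightarrow> (\<And>k. 0 < width u v k) \<Longrightarrow>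
        card {k. width u v k < min C C4} \<le> m \<Longrightarrow> C5 \<le> width u v k"
    and gap5: "\<And>u v k. u \<in> Lambda n r \<alpha> \<Longrightarrow> v \<in> Lambda n r \<alpha> \<Longrightarrow> (\<And>k. C5 \<le> width u v k) \<Longrightarrow>
        (lo v k \<noteq> lo u k \<longrightarrow> G5 \<le> \<bar>lo v k - lo u k\<bar>) \<and> (hi v k \<noteq> hi u k \<longrightarrow> G5 \<le> \<bar>hi v k - hi u k\<bar>)"
    and C6: "C6 \<le> rmin * \<alpha> / 4" "C6 \<le> G5"
    and IH7: "\<And>u v k. u \<in> Lambda n r \<alpha> \<Longrightarrow> v \<in> Lambda n r \<alpha> \<Longrightarrow> (\<And>k. 0 < width u v k) \<Longrightarrow>
        card {k. width u v k < min C C6} \<le> m \<Longrightarrow> C7 \<le> width u v k"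
    and gap2: "\<And>u v w k. u \<in> Lambda n r \<alpha> \<Longrightarrow> v \<in> Lambda n r \<alpha> \<Longrightarrow> w \<in> Lambda n r \<alpha> \<Longrightarrow>
        (\<And>k. C7 \<le> width u v k) \<Longrightarrow> (\<And>k. C5 \<le> width v w k) \<Longrightarrow> width u w k \<noteq> 0 \<Longrightarrow> G2 \<le> \<bar>width u w k\<bar>"
    and gap_sib: "\<And>w i j k. w \<in> words n \<Longrightarrow> i \<le> n \<Longrightarrow> j \<le> n \<Longrightarrow> rmin * \<alpha> \<le> rat (w @ [i]) \<Longrightarrow>
        width (w @ [i]) (w @ [j]) k \<noteq> 0 \<Longrightarrow> E \<le> \<bar>width (w @ [i]) (w @ [j]) k\<bar>"
begin

text \<open>The new cell \<kappa> descends from \<open>W\<close> and passes through a point just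
  beyond a face of \<sigma>. First \<kappa> is shown to overlap \<tau> widely, which makes its faces
  discrete relative to \<tau>. Then its overlap with \<sigma> must be small on \<open>T\<close>,
  hence equal to the old one there.\<close>

lemma replace_by_relative:
  assumes \<sigma>: "\<sigma> \<in> Lambda n r \<alpha>" and \<tau>: "\<tau> \<in> Lambda n r \<alpha>" and meets: "meets T a b \<sigma> \<tau>"
    and prefix: "\<sigma> = W @ s" and k0: "k0 \<in> T"
    and y: "lo W k0 < y" "y < hi W k0" "lo \<tau> k0 < y" "y < hi \<tau> k0" "y < lo \<sigma> k0 \<or> hi \<sigma> k0 < y"
      "a k0 - \<alpha> < y" "y < b k0 + \<alpha>"
    and y_generic: "\<And>u. u \<in> Lambda n r \<alpha> \<Longrightarrow> lo u k0 \<le> y \<Longrightarrow> y \<le> hi u k0 \<Longrightarrow>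
        lo u k0 \<le> b k0 \<and> a k0 \<le> hi u k0 \<and> lo u k0 < y \<and> y < hi u k0"
  shows "\<exists>v. W @ v \<in> Lambda n r \<alpha> \<and> meets T a b \<sigma> (W @ v)"
proof -
  note \<sigma>w = Lambda_words[OF \<sigma>] and \<sigma>r = Lambda_rat[OF \<sigma> \<alpha>]
  note \<tau>w = Lambda_words[OF \<tau>] and \<tau>r = Lambda_rat[OF \<tau> \<alpha>]
  have Ww: "W \<in> words n" "s \<in> words n" using \<sigma>w prefix by auto
  define H where "H k = (\<lambda>u. lo u k) ` Lambda n r \<alpha> \<union> (\<lambda>u. hi u k) ` Lambda n r \<alpha>" for k
  have "finite (H k)" for k using finite_Lambda[OF \<alpha>] by (simp add: H_def)
  then have "\<forall>k. \<exists>c. a k < c \<and> c < b k \<and> H k \<inter> {a k<..c} = {}"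
    using right_neighbourhood_avoiding_finite[OF _ ab] by blast
  from choice[OF this] obtain f where f: "\<And>k. a k < f k" "\<And>k. f k < b k" "\<And>k. H k \<inter> {a k<..f k} = {}"
    by blast
  have f_face: "lo u k \<noteq> f k" "hi u k \<noteq> f k" if "u \<in> Lambda n r \<alpha>" for u k
    using f(1)[of k] f(3)[of k] that by (auto simp: H_def)
  \<comment> \<open>Coordinate \<open>k0\<close> lies beyond the face of \<sigma>; all others stay
    inside \<open>[a, b]\<close>. In the other tiny coordinates \<open>f k\<close> avoids all faces
    of level \<alpha>, so a cell containing \<open>x\<close> contains it strictly there.\<close>
  define x :: "real ^ 'd" where "x = (\<chi> k. if k = k0 then y else if k \<in> T then f k else (a k + b k) / 2)"
  have x_in: "a k < x $ k" "x $ k < b k" if "k \<noteq> k0" for k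
    using f(1,2)[of k] ab[of k] that by (auto simp: x_def)
  have x_k0: "x $ k0 = y" by (simp add: x_def)
  have "x \<in> cell W"
    unfolding cell_def
  proof (intro CollectI allI)
    fix k show "lo W k \<le> x $ k \<and> x $ k \<le> hi W k"
      using lo_hi_append[OF Ww, of k] meets_bounds[OF meets, of k] x_in[of k] y x_k0
      by (cases "k = k0") (auto simp: prefix)
  qed
  \<comment> \<open>Strictly between the faces of \<open>W\<close> but outside \<sigma> in
    coordinate \<open>k0\<close>, \<open>y\<close> shows that the two cells differ. Thus
    \<open>W\<close> is a proper prefix and its ratio is at least \<alpha>.\<close>
  have "s \<noteq> []" using y prefix by auto
  then have "\<alpha> \<le> rat W * rat (butlast s)"
    using \<sigma> by (simp add: Lambda_def prefix butlast_append)
  also have "\<dots> \<le> rat W * 1"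
  proof (intro mult_left_mono rat_le_1)
    show "butlast s \<in> words n" using Ww(2) by (auto simp: words_def dest: in_set_butlastD)
    show "0 \<le> rat W" using rat_pos[OF Ww(1)] by simp
  qed
  finally obtain v where \<kappa>: "W @ v \<in> Lambda n r \<alpha>" "x \<in> cell (W @ v)"
    using Lambda_extension[OF Ww(1) \<open>x \<in> cell W\<close> \<alpha>] by auto
  define \<kappa> where "\<kappa> = W @ v"
  have \<kappa>L: "\<kappa> \<in> Lambda n r \<alpha>" using \<kappa> by (simp add: \<kappa>_def)
  note \<kappa>r = Lambda_rat[OF \<kappa>L \<alpha>]
  have x\<kappa>: "lo \<kappa> k \<le> x $ k" "x $ k \<le> hi \<kappa> k" for k
    using \<kappa>(2) by (auto simp: cell_def \<kappa>_def)
  have len: "rmin * \<alpha> \<le> hi \<sigma> k - lo \<sigma> k" "rmin * \<alpha> \<le> hi \<tau> k - lo \<tau> k" "rmin * \<alpha> \<le> hi \<kappa> k - lo \<kappa> k" for k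
    using \<sigma>r \<tau>r \<kappa>r by (simp_all add: hi_minus_lo)
  have "norm (centre \<kappa> - z) \<le> CARD('d) * (3 * \<alpha>)"
  proof (rule norm_le_of_components)
    fix k
    have "\<bar>x $ k - z $ k\<bar> \<le> 2 * \<alpha>"
      using z[of k] x_in[of k] y x_k0 ab[of k] \<alpha> by (cases "k = k0") (auto simp: abs_le_iff)
    moreover have "\<bar>centre \<kappa> $ k - x $ k\<bar> \<le> \<alpha>"
      using x\<kappa>[of k] \<kappa>r unfolding lo_def hi_def by linarith
    ultimately show "\<bar>(centre \<kappa> - z) $ k\<bar> \<le> 3 * \<alpha>" by simp
  qed
  then have faces: "lo \<kappa> k \<notin> {a k<..<b k} \<and> hi \<kappa> k \<notin> {a k<..<b k}" if "k \<notin> T" for k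
    using near[OF \<kappa>L] that by blast
  have off_T: "lo \<kappa> k \<le> a k" "b k \<le> hi \<kappa> k" if "k \<notin> T" for k
    using faces[OF that] x\<kappa>[of k] x_in[of k] that k0 by force+
  have wide_off_T: "C \<le> width \<sigma> \<kappa> k" "C \<le> width \<tau> \<kappa> k" "0 < width \<sigma> \<kappa> k" "0 < width \<tau> \<kappa> k" if "k \<notin> T" for k
    using off_T[OF that] meets_bounds[OF meets, of k] wide[OF that] ab[of k]
    by (auto simp: width_def)
  have touch: "lo \<kappa> k \<le> b k" "a k \<le> hi \<kappa> k" for k
    using x\<kappa>[of k] x_in[of k] y_generic[OF \<kappa>L] x_k0 by (cases "k = k0"; force)+
  have eq: "max (lo \<sigma> k) (lo \<tau> k) = a k" "min (hi \<sigma> k) (hi \<tau> k) = b k" if "k \<in> T" for k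
    using meets that by (auto simp: meets_def)
  have pos_\<tau>: "0 < width \<tau> \<kappa> k" for k
  proof (cases "k \<in> T")
    case True
    show ?thesis
    proof (cases "k = k0")
      case True
      then show ?thesis using y y_generic[OF \<kappa>L] x\<kappa>[of k0] x_k0 by (auto simp: width_def)
    next
      case False
      then have "x $ k = f k" using \<open>k \<in> T\<close> by (simp add: x_def)
      then have "lo \<kappa> k < x $ k" "x $ k < hi \<kappa> k"
        using x\<kappa>[of k] f_face[OF \<kappa>L, of k] by auto
      then show ?thesis using x_in[OF False] meets_bounds[OF meets, of k] by (auto simp: width_def)
    qed
  qed (use wide_off_T in auto)
  note tiny = eq[OF k0] ab small[OF k0] E(1) len touch
  \<comment> \<open>One wide coordinate in \<open>T\<close> leaves at most \<open>m\<close> narrow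
    ones, as the induction hypothesis requires.\<close>
  have card_less: "card {k. width u v k < min C D} \<le> m"
    if "k \<in> T" "D \<le> width u v k" "\<And>k. k \<notin> T \<Longrightarrow> C \<le> width u v k" for u v k D
  proof -
    have "{k. width u v k < min C D} \<subseteq> T - {k}" using that(2,3) by force
    then have "card {k. width u v k < min C D} \<le> card (T - {k})" by (intro card_mono) auto
    then show ?thesis using card_T that(1) by (simp add: card_Diff_singleton)
  qed
  \<comment> \<open>Otherwise \<kappa> overlaps \<sigma> widely in every coordinate, so its faces
    are discrete relative to \<sigma>. Its protrusion at \<open>y\<close> then forces an overlap of
    at least \<open>C4\<close> with \<tau> in coordinate \<open>k0\<close>.\<close>
  have "\<exists>k\<in>T. C4 \<le> width \<tau> \<kappa> k"
  proof (rule ccontr)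
    assume "\<not> ?thesis"
    then have less: "width \<kappa> \<tau> k < C4" if "k \<in> T" for k
      using that by (auto simp: not_le width_commute[of \<kappa>])
    have "rmin * \<alpha> / 4 \<le> width \<sigma> \<kappa> k" if "k \<in> T" for k
      using big_overlap_with_one[OF eq[OF that] ab small[OF that] E(1) len touch] less[OF that] C4
      by (simp add: width_def min.commute max.commute)
    then have "min C (rmin * \<alpha> / 4) \<le> width \<sigma> \<kappa> k" for k
      using wide_off_T(1)[of k] by (cases "k \<in> T") (auto simp: min.coboundedI1 min.coboundedI2)
    from gap4[OF \<sigma> \<kappa>L this] show False
      using no_protrusion[OF eq[OF k0] ab small[OF k0] E(1) len touch, of y C4]
        x\<kappa>[of k0] y less[OF k0] C4 unfolding x_k0 width_def by blast
  qed
  then have "C5 \<le> width \<tau> \<kappa> k" for k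
    using card_less[of _ C4 \<tau> \<kappa>] wide_off_T IH5[OF \<tau> \<kappa>L pos_\<tau>] by blast
  note C5 = this
  note g5 = gap5[OF \<tau> \<kappa>L C5]
  have pos_\<sigma>: "0 < width \<sigma> \<kappa> k" for k
  proof (cases "k \<in> T")
    case True
    show ?thesis
      unfolding width_def
      by (rule proper_overlap[OF eq[OF True] ab small[OF True] E(1) len touch, of G5])
        (use g5 E in auto)
  qed (use wide_off_T in auto)
  \<comment> \<open>One width of \<open>C6\<close> would make all widths with \<sigma> at least
    \<open>C7\<close>. The chain \<sigma>, \<kappa>, \<tau> then has discrete relative positions,
    and \<sigma> and \<tau> could not overlap as little as \<open>b k - a k\<close>.\<close>
  have less: "width \<sigma> \<kappa> k < C6" if "k \<in> T" for k
  proof (rule ccontr)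
    assume "\<not> ?thesis"
    then have "C7 \<le> width \<sigma> \<kappa> k" for k
      using card_less[OF that, of C6 \<sigma> \<kappa>] wide_off_T IH7[OF \<sigma> \<kappa>L pos_\<sigma>] by auto
    moreover have "width \<sigma> \<tau> k = b k - a k" using eq[OF that] by (simp add: width_def)
    ultimately have "G2 \<le> b k - a k"
      using gap2[OF \<sigma> \<kappa>L \<tau>, of k] C5 ab[of k] by (simp add: width_commute[of \<kappa>])
    then show False using small[OF that] E by simp
  qed
  have "max (lo \<sigma> k) (lo \<kappa> k) = a k \<and> min (hi \<sigma> k) (hi \<kappa> k) = b k" if "k \<in> T" for k
    by (rule same_overlap[OF eq[OF that] ab small[OF that] E(1) len touch, of G5 C6])
      (use g5 E C6 less[OF that] in \<open>auto simp: width_def\<close>)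
  then have "meets T a b \<sigma> \<kappa>"
    using off_T meets by (auto simp: meets_def)
  then show ?thesis using \<kappa>L by (auto simp: \<kappa>_def)
qed

text \<open>Finiteness of the level provides a pair with longest common prefix. Sibling cells above
  it overlap by more than the pair does, so one extends beyond its own subcell, and
  \<open>replace_by_relative\<close> produces a pair with a longer common prefix.\<close>

lemma no_tiny_overlap:
  assumes "\<sigma> \<in> Lambda n r \<alpha>" "\<tau> \<in> Lambda n r \<alpha>" "meets T a b \<sigma> \<tau>" "k0 \<in> T"
  shows False
proof -
  define P where "P = (\<lambda>l. \<exists>u v w. u \<in> Lambda n r \<alpha> \<and> v \<in> Lambda n r \<alpha> \<and> meets T a b u v \<and>
      length w = l \<and> (\<exists>s. u = w @ s) \<and> (\<exists>s. v = w @ s))"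
  have "P 0" using assms by (auto simp: P_def)
  moreover have "l < Suc (Max (length ` Lambda n r \<alpha>))" if "P l" for l
  proof -
    obtain u where "u \<in> Lambda n r \<alpha>" "l \<le> length u" using \<open>P l\<close> by (auto simp: P_def)
    moreover have "length u \<le> Max (length ` Lambda n r \<alpha>)"
      using finite_Lambda[OF \<alpha>] \<open>u \<in> Lambda n r \<alpha>\<close> by simp
    ultimately show ?thesis by simp
  qed
  ultimately obtain l where l: "P l" "\<And>l'. P l' \<Longrightarrow> l' \<le> l"
    using ex_has_greatest_nat[of P 0 id] by (metis id_apply)
  then obtain \<sigma> \<tau> w s s' where \<sigma>: "\<sigma> \<in> Lambda n r \<alpha>" "\<sigma> = w @ s" and \<tau>: "\<tau> \<in> Lambda n r \<alpha>" "\<tau> = w @ s'"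
    and meets: "meets T a b \<sigma> \<tau>" and w: "length w = l"
    by (auto simp: P_def)
  have longer: False
    if "u \<in> Lambda n r \<alpha>" "v \<in> Lambda n r \<alpha>" "meets T a b u v" "length w' = Suc l" "u = w' @ p" "v = w' @ q" for u v w' p q
    using l(2)[of "Suc l"] that by (auto simp: P_def)
  \<comment> \<open>A cell overlaps itself in its full side length, which is not tiny. With
    prefix-freeness this makes both words continue beyond \<open>w\<close>.\<close>
  have ne: "u \<noteq> v" if "meets T a b u v" "u \<in> Lambda n r \<alpha>" for u v
  proof
    assume "u = v"
    then have "rat u = b k0 - a k0"
      using that(1) assms(4) hi_minus_lo[of v k0] by (auto simp: meets_def)
    moreover have "0 < rmin * \<alpha>" using rmin \<alpha> by simp
    ultimately show False using small[OF assms(4)] E Lambda_rat[OF that(2) \<alpha>] by linarith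
  qed
  have "s \<noteq> []"
    using ne[OF meets \<sigma>(1)] Lambda_prefix_eq[of w \<alpha> s'] \<sigma> \<tau> by auto
  moreover have "s' \<noteq> []"
    using ne[OF meets \<sigma>(1)] Lambda_prefix_eq[of w \<alpha> s] \<sigma> \<tau> by auto
  ultimately obtain i s1 j s1' where s: "s = i # s1" "s' = j # s1'" by (meson neq_Nil_conv)
  define W where "W = w @ [i]"
  define V where "V = w @ [j]"
  have \<sigma>W: "\<sigma> = W @ s1" and \<tau>V: "\<tau> = V @ s1'" using \<sigma> \<tau> s by (auto simp: W_def V_def)
  have words: "W \<in> words n" "s1 \<in> words n" "V \<in> words n" "s1' \<in> words n" "w \<in> words n" "i \<le> n" "j \<le> n"
    using Lambda_words[OF \<sigma>(1)] Lambda_words[OF \<tau>(1)] \<sigma> \<tau> s by (auto simp: W_def V_def)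
  \<comment> \<open>Stated for an arbitrary pair because either cell may be the one whose ancestor
    extends further. The contradiction comes from the pair of \<sigma> and its replacement, which
    share the prefix \<open>W\<close>.\<close>
  have False_if: False
    if \<sigma>: "\<sigma> \<in> Lambda n r \<alpha>" and \<tau>: "\<tau> \<in> Lambda n r \<alpha>" and meets: "meets T a b \<sigma> \<tau>"
      and W: "\<sigma> = W @ s" "length W = Suc l" "W \<in> words n"
      and inner: "(b k0 < hi W k0 \<and> hi \<sigma> k0 = b k0) \<or> (lo W k0 < a k0 \<and> lo \<sigma> k0 = a k0)" for \<sigma> \<tau> W s
  proof -
    have sw: "s \<in> words n" using Lambda_words[OF \<sigma>] W by simp
    have eq: "max (lo \<sigma> k0) (lo \<tau> k0) = a k0" "min (hi \<sigma> k0) (hi \<tau> k0) = b k0"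
      using meets assms(4) by (auto simp: meets_def)
    have "rmin * \<alpha> \<le> hi \<sigma> k0 - lo \<sigma> k0" "rmin * \<alpha> \<le> hi \<tau> k0 - lo \<tau> k0"
      using Lambda_rat[OF \<sigma> \<alpha>] Lambda_rat[OF \<tau> \<alpha>] by (simp_all add: hi_minus_lo)
    then have orient: "(lo \<sigma> k0 < a k0 \<and> lo \<tau> k0 = a k0 \<and> hi \<sigma> k0 = b k0 \<and> b k0 < hi \<tau> k0) \<or>
        (lo \<tau> k0 < a k0 \<and> lo \<sigma> k0 = a k0 \<and> hi \<tau> k0 = b k0 \<and> b k0 < hi \<sigma> k0)"
      \<comment> \<open>The third interval demanded there is taken to be that of \<sigma>
        itself.\<close>
      using tiny_overlap_orientation[OF eq ab small[OF assms(4)] E(1), where lk = "lo \<sigma> k0" and hk = "hi \<sigma> k0"]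
        ab[of k0] meets_bounds[OF meets, of k0] by (meson le_less_trans less_imp_le less_le_trans)
    have WW: "lo W k0 \<le> lo \<sigma> k0" "hi \<sigma> k0 \<le> hi W k0"
      using lo_hi_append[OF W(3) sw, of k0] by (auto simp: W(1))
    define H where "H = (\<lambda>u. lo u k0) ` Lambda n r \<alpha> \<union> (\<lambda>u. hi u k0) ` Lambda n r \<alpha>"
    have H: "finite H" using finite_Lambda[OF \<alpha>] by (simp add: H_def)
    have "\<exists>v. W @ v \<in> Lambda n r \<alpha> \<and> meets T a b \<sigma> (W @ v)"
      using inner
    proof
      assume r: "b k0 < hi W k0 \<and> hi \<sigma> k0 = b k0"
      then have "b k0 < hi \<tau> k0" using orient by auto
      \<comment> \<open>No face lies in the interval from \<open>b k0\<close> (exclusive) to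
        \<open>y\<close>, so every cell of the level that reaches \<open>y\<close> also reaches back
        to \<open>b k0\<close> and contains \<open>y\<close> strictly.\<close>
      then obtain y where y: "b k0 < y" "y < min (min (hi \<tau> k0) (hi W k0)) (b k0 + \<alpha>)" "H \<inter> {b k0<..y} = {}"
        using right_neighbourhood_avoiding_finite[OF H, of "b k0" "min (min (hi \<tau> k0) (hi W k0)) (b k0 + \<alpha>)"]
          r \<alpha> by auto
      have gen: "lo u k0 \<le> b k0 \<and> a k0 \<le> hi u k0 \<and> lo u k0 < y \<and> y < hi u k0"
        if "u \<in> Lambda n r \<alpha>" "lo u k0 \<le> y" "y \<le> hi u k0" for u
      proof -
        have "lo u k0 \<notin> {b k0<..y}" "hi u k0 \<notin> {b k0<..y}" using y(3) that(1) by (auto simp: H_def)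
        then show ?thesis using that y(1) ab[of k0] by auto
      qed
      show ?thesis
        by (rule replace_by_relative[OF \<sigma> \<tau> meets W(1) assms(4) _ _ _ _ _ _ _ gen])
          (use y r WW orient ab[of k0] \<alpha> in auto)
    next
      assume r: "lo W k0 < a k0 \<and> lo \<sigma> k0 = a k0"
      then have "lo \<tau> k0 < a k0" using orient by auto
      then obtain y where y: "y < a k0" "max (max (lo \<tau> k0) (lo W k0)) (a k0 - \<alpha>) < y" "H \<inter> {y..<a k0} = {}"
        using left_neighbourhood_avoiding_finite[OF H, of "max (max (lo \<tau> k0) (lo W k0)) (a k0 - \<alpha>)" "a k0"]
          r \<alpha> by auto
      have gen: "lo u k0 \<le> b k0 \<and> a k0 \<le> hi u k0 \<and> lo u k0 < y \<and> y < hi u k0"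
        if "u \<in> Lambda n r \<alpha>" "lo u k0 \<le> y" "y \<le> hi u k0" for u
      proof -
        have "lo u k0 \<notin> {y..<a k0}" "hi u k0 \<notin> {y..<a k0}" using y(3) that(1) by (auto simp: H_def)
        then show ?thesis using that y(1) ab[of k0] by auto
      qed
      show ?thesis
        by (rule replace_by_relative[OF \<sigma> \<tau> meets W(1) assms(4) _ _ _ _ _ _ _ gen])
          (use y r WW orient ab[of k0] \<alpha> in auto)
    qed
    then show False using longer[OF \<sigma> _ _ W(2,1)] by blast
  qed
  have lohi: "lo W k0 \<le> lo \<sigma> k0" "hi \<sigma> k0 \<le> hi W k0" "lo V k0 \<le> lo \<tau> k0" "hi \<tau> k0 \<le> hi V k0"
    using lo_hi_append[OF words(1,2), of k0] lo_hi_append[OF words(3,4), of k0] by (auto simp: \<sigma>W \<tau>V)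
  note mb = meets_bounds[OF meets, of k0]
  have eq: "max (lo \<sigma> k0) (lo \<tau> k0) = a k0" "min (hi \<sigma> k0) (hi \<tau> k0) = b k0"
    using meets assms(4) by (auto simp: meets_def)
  have "rat \<sigma> \<le> rat W * 1"
    unfolding \<sigma>W rat_append using words rat_pos[OF words(1)]
    by (intro mult_left_mono rat_le_1) (auto simp del: rat_pos)
  then have "rmin * \<alpha> \<le> rat W" using Lambda_rat[OF \<sigma>(1) \<alpha>] by simp
  moreover have "b k0 - a k0 \<le> width W V k0"
    using lohi mb unfolding width_def by linarith
  \<comment> \<open>The width is at least \<open>b k0 - a k0\<close>, hence nonzero, and the sibling
    gap applies. Since \<open>E\<close> exceeds the tiny overlap, that of \<open>W\<close> and
    \<open>V\<close> is strictly larger.\<close>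
  ultimately have "E \<le> width W V k0"
    using gap_sib[OF words(5-7), of k0] ab[of k0] unfolding W_def V_def by fastforce
  then have "max (lo W k0) (lo V k0) < a k0 \<or> b k0 < min (hi W k0) (hi V k0)"
    using small[OF assms(4)] unfolding width_def by linarith
  then have "((b k0 < hi W k0 \<and> hi \<sigma> k0 = b k0) \<or> (lo W k0 < a k0 \<and> lo \<sigma> k0 = a k0)) \<or>
      ((b k0 < hi V k0 \<and> hi \<tau> k0 = b k0) \<or> (lo V k0 < a k0 \<and> lo \<tau> k0 = a k0))"
    using eq by (auto simp: min_def max_def split: if_splits)
  then show False
    using False_if[OF \<sigma>(1) \<tau>(1) meets \<sigma>W _ words(1)]
      False_if[OF \<tau>(1) \<sigma>(1) _ \<tau>V _ words(3)] meets w
    by (auto simp: W_def V_def meets_commute[of T a b \<tau>])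
qed

end

subsection \<open>Lower bound for the widths of overlaps\<close>

text \<open>The number \<open>m\<close> of coordinates that may be narrow is the induction
  parameter; the value \<open>CARD('d)\<close> admits every pair of overlapping cells.\<close>

definition width_bound :: "nat \<Rightarrow> real \<Rightarrow> real \<Rightarrow> bool" where
  "width_bound m c \<epsilon> \<longleftrightarrow> (\<forall>\<alpha>>0. \<forall>u\<in>Lambda n r \<alpha>. \<forall>v\<in>Lambda n r \<alpha>. (\<forall>k. 0 < width u v k) \<longrightarrow>
     card {k. width u v k < c * \<alpha>} \<le> m \<longrightarrow> (\<forall>k. \<epsilon> * \<alpha> \<le> width u v k))"

lemma width_boundD:
  "width_bound m c \<epsilon> \<Longrightarrow> 0 < \<alpha> \<Longrightarrow> u \<in> Lambda n r \<alpha> \<Longrightarrow> v \<in> Lambda n r \<alpha> \<Longrightarrow>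
     (\<And>k. 0 < width u v k) \<Longrightarrow> card {k. width u v k < c * \<alpha>} \<le> m \<Longrightarrow> \<epsilon> * \<alpha> \<le> width u v k"
  unfolding width_bound_def by blast

definition rels :: "real \<Rightarrow> (real \<times> (real ^ 'd)) set" where
  "rels c = {rel u v |u v. \<exists>\<alpha>>0. u \<in> Lambda n r \<alpha> \<and> v \<in> Lambda n r \<alpha> \<and> (\<forall>k. c * \<alpha> \<le> width u v k)}"

lemma relsI:
  "0 < \<alpha> \<Longrightarrow> u \<in> Lambda n r \<alpha> \<Longrightarrow> v \<in> Lambda n r \<alpha> \<Longrightarrow> (\<And>k. c * \<alpha> \<le> width u v k) \<Longrightarrow> rel u v \<in> rels c"
  unfolding rels_def by blast

lemma rels_gap:
  assumes "0 < c"
  shows "\<exists>g>0. \<forall>\<alpha>>0. \<forall>u\<in>Lambda n r \<alpha>. \<forall>v\<in>Lambda n r \<alpha>. (\<forall>k. c * \<alpha> \<le> width u v k) \<longrightarrow> (\<forall>k.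
    (lo v k \<noteq> lo u k \<longrightarrow> g * \<alpha> \<le> \<bar>lo v k - lo u k\<bar>) \<and> (hi v k \<noteq> hi u k \<longrightarrow> g * \<alpha> \<le> \<bar>hi v k - hi u k\<bar>))"
proof -
  have "finite (rels c)" using finite_rel[OF assms] by (simp add: rels_def)
  then obtain g where g: "0 < g" "\<forall>\<alpha>>0. \<forall>u\<in>words n. \<forall>v. \<forall>k. rmin * \<alpha> \<le> rat u \<longrightarrow> rel u v \<in> rels c \<longrightarrow>
    (width u v k \<noteq> 0 \<longrightarrow> g * \<alpha> \<le> \<bar>width u v k\<bar>) \<and>
    (lo v k \<noteq> lo u k \<longrightarrow> g * \<alpha> \<le> \<bar>lo v k - lo u k\<bar>) \<and>
    (hi v k \<noteq> hi u k \<longrightarrow> g * \<alpha> \<le> \<bar>hi v k - hi u k\<bar>)"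
    using finite_rel_gap by blast
  show ?thesis
  proof (intro exI[of _ g] conjI[OF g(1)] allI impI ballI)
    fix \<alpha> :: real and u v k
    assume *: "0 < \<alpha>" "u \<in> Lambda n r \<alpha>" "v \<in> Lambda n r \<alpha>" "\<forall>k. c * \<alpha> \<le> width u v k"
    then have "rel u v \<in> rels c" by (intro relsI) auto
    then show "(lo v k \<noteq> lo u k \<longrightarrow> g * \<alpha> \<le> \<bar>lo v k - lo u k\<bar>) \<and> (hi v k \<noteq> hi u k \<longrightarrow> g * \<alpha> \<le> \<bar>hi v k - hi u k\<bar>)"
      using g(2) * Lambda_words[OF *(2)] Lambda_rat[OF *(2,1)] by blast
  qed
qed

lemma finite_rel_width_gap:
  assumes "finite Z"
  shows "\<exists>g>0. \<forall>\<alpha>>0. \<forall>u\<in>words n. \<forall>v k. rmin * \<alpha> \<le> rat u \<longrightarrow> rel u v \<in> Z \<longrightarrow>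
    width u v k \<noteq> 0 \<longrightarrow> g * \<alpha> \<le> \<bar>width u v k\<bar>"
  using finite_rel_gap[OF assms] by (elim ex_forward conj_forward) blast+

text \<open>The threshold \<open>c\<close> is generalised because the induction hypothesis serves at
  three smaller thresholds. If no coordinate is narrow, \<open>c\<close> works; if some narrow width
  is at least \<open>e * \<alpha>\<close>, at most \<open>m\<close> lie below that threshold; if all
  narrow widths are below it, \<open>no_tiny_overlap\<close> gives a contradiction.\<close>

lemma width_bound_ex: "0 < c \<Longrightarrow> \<exists>\<epsilon>>0. width_bound m c \<epsilon>"
proof (induction m arbitrary: c)
  case 0
  then show ?case
    by (intro exI[of _ c]) (auto simp: width_bound_def not_less)
next
  case (Suc m)
  \<comment> \<open>Replacement cells have centres within \<open>3 * \<alpha>\<close> of the centre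
    of \<open>u\<close> in each coordinate; the dimension turns this into a bound on the
    norm.\<close>
  define R where "R = real CARD('d) * 3"
  obtain Q where Q: "\<forall>\<alpha>>0. \<forall>x. card ((\<lambda>u. (centre u, rat u)) `
      {u \<in> Lambda n r \<alpha>. norm (centre u - x) \<le> R * \<alpha>}) \<le> Q"
    using nearby_cells_bounded ..
  \<comment> \<open>The at most \<open>Q\<close> nearby cells have two faces per coordinate, and
    avoiding each face may halve the interval.\<close>
  define c' where "c' = c / 2 ^ (Q + Q)"
  have c': "0 < c'" using Suc.prems by (simp add: c'_def)
  have "0 < min c' (rmin / 4)" using c' rmin by simp
  from rels_gap[OF this] obtain g4 where g4: "0 < g4" "\<forall>\<alpha>>0. \<forall>u\<in>Lambda n r \<alpha>. \<forall>v\<in>Lambda n r \<alpha>.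
      (\<forall>k. min c' (rmin / 4) * \<alpha> \<le> width u v k) \<longrightarrow> (\<forall>k.
      (lo v k \<noteq> lo u k \<longrightarrow> g4 * \<alpha> \<le> \<bar>lo v k - lo u k\<bar>) \<and> (hi v k \<noteq> hi u k \<longrightarrow> g4 * \<alpha> \<le> \<bar>hi v k - hi u k\<bar>))"
    by blast
  define c4 where "c4 = min (rmin / 4) g4"
  have c4: "0 < c4" "c4 \<le> rmin / 4" "c4 \<le> g4" using rmin g4 by (auto simp: c4_def)
  obtain c5 where c5: "0 < c5" "width_bound m (min c' c4) c5"
    using Suc.IH[of "min c' c4"] c' c4 by auto
  from rels_gap[OF c5(1)] obtain g5 where g5: "0 < g5" "\<forall>\<alpha>>0. \<forall>u\<in>Lambda n r \<alpha>. \<forall>v\<in>Lambda n r \<alpha>.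
      (\<forall>k. c5 * \<alpha> \<le> width u v k) \<longrightarrow> (\<forall>k.
      (lo v k \<noteq> lo u k \<longrightarrow> g5 * \<alpha> \<le> \<bar>lo v k - lo u k\<bar>) \<and> (hi v k \<noteq> hi u k \<longrightarrow> g5 * \<alpha> \<le> \<bar>hi v k - hi u k\<bar>))"
    by blast
  define c6 where "c6 = min (rmin / 4) g5"
  have c6: "0 < c6" "c6 \<le> rmin / 4" "c6 \<le> g5" using rmin g5 by (auto simp: c6_def)
  obtain c7 where c7: "0 < c7" "width_bound m (min c' c6) c7"
    using Suc.IH[of "min c' c6"] c' c6 by auto
  \<comment> \<open>Compositions of relative positions along chains of three cells, as in
    \<open>rel_trans\<close>.\<close>
  define Z where "Z = (\<lambda>(p, q). (fst p * fst q, snd p + fst p *\<^sub>R snd q)) ` (rels c7 \<times> rels c5)"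
  have "finite Z" using finite_rel[OF c5(1)] finite_rel[OF c7(1)] by (simp add: Z_def rels_def)
  from finite_rel_width_gap[OF this] obtain g2 where g2: "0 < g2"
    "\<forall>\<alpha>>0. \<forall>u\<in>words n. \<forall>v k. rmin * \<alpha> \<le> rat u \<longrightarrow> rel u v \<in> Z \<longrightarrow>
      width u v k \<noteq> 0 \<longrightarrow> g2 * \<alpha> \<le> \<bar>width u v k\<bar>" by blast
  from finite_rel_width_gap[OF finite_rel_siblings] obtain g0 where g0: "0 < g0"
    "\<forall>\<alpha>>0. \<forall>u\<in>words n. \<forall>v k. rmin * \<alpha> \<le> rat u \<longrightarrow>
      rel u v \<in> {rel (w @ [i]) (w @ [j]) |w i j. w \<in> words n \<and> i \<le> n \<and> j \<le> n} \<longrightarrow>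
      width u v k \<noteq> 0 \<longrightarrow> g0 * \<alpha> \<le> \<bar>width u v k\<bar>" by blast
  \<comment> \<open>The largest tininess threshold compatible with all gaps used by
    \<open>no_tiny_overlap\<close>; the bound by \<open>c\<close> is for the case of a moderately
    narrow coordinate.\<close>
  define e where "e = Min {c, rmin / 4, g5, g2, g0}"
  have e: "0 < e" "e \<le> c" "e \<le> rmin / 4" "e \<le> g5" "e \<le> g2" "e \<le> g0"
    using Suc.prems rmin(1) g5 g2 g0 by (auto simp: e_def)
  obtain \<epsilon> where \<epsilon>: "0 < \<epsilon>" "width_bound m e \<epsilon>" using Suc.IH[OF e(1)] by blast
  have "min c \<epsilon> * \<alpha> \<le> width u v k1"
    if \<alpha>: "0 < \<alpha>" and u: "u \<in> Lambda n r \<alpha>" and v: "v \<in> Lambda n r \<alpha>" and pos: "\<And>k. 0 < width u v k"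
      and card: "card {k. width u v k < c * \<alpha>} \<le> Suc m" for \<alpha> u v k1
  proof -
    define T where "T = {k. width u v k < c * \<alpha>}"
    consider "T = {}" | k where "k \<in> T" "e * \<alpha> \<le> width u v k" |
      k0 where "k0 \<in> T" "\<And>k. k \<in> T \<Longrightarrow> width u v k < e * \<alpha>"
      using not_less by blast
    then show ?thesis
    proof cases
      case 1
      then have "c * \<alpha> \<le> width u v k1" by (auto simp: T_def not_less)
      moreover have "min c \<epsilon> * \<alpha> \<le> c * \<alpha>" using \<alpha> by (intro mult_right_mono) auto
      ultimately show ?thesis by linarith
    next
      case (2 k)
      have "e * \<alpha> \<le> c * \<alpha>" using e \<alpha> by (intro mult_right_mono) auto
      then have "{k. width u v k < e * \<alpha>} \<subseteq> T - {k}" using 2 by (auto simp: T_def)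
      then have "card {k. width u v k < e * \<alpha>} \<le> card (T - {k})" by (intro card_mono) auto
      also have "\<dots> \<le> m" using card 2(1) by (simp add: card_Diff_singleton T_def)
      finally have "\<epsilon> * \<alpha> \<le> width u v k1" using width_boundD[OF \<epsilon>(2) \<alpha> u v pos] by blast
      moreover have "min c \<epsilon> * \<alpha> \<le> \<epsilon> * \<alpha>" using \<alpha> by (intro mult_right_mono) auto
      ultimately show ?thesis by linarith
    next
      case (3 k0)
      define N where "N = (\<lambda>u. (centre u, rat u)) ` {w \<in> Lambda n r \<alpha>. norm (centre w - centre u) \<le> R * \<alpha>}"
      have N: "finite N" "card N \<le> Q"
        using finite_Lambda[OF \<alpha>] Q \<alpha> by (auto simp: N_def)
      define H where "H k = (\<lambda>(x, \<rho>). x $ k - \<rho> / 2) ` N \<union> (\<lambda>(x, \<rho>). x $ k + \<rho> / 2) ` N" for k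
      have H: "finite (H k)" "card (H k) \<le> Q + Q" for k
      proof -
        show "finite (H k)" using N by (simp add: H_def)
        have "card (H k) \<le> card ((\<lambda>(x, \<rho>). x $ k - \<rho> / 2) ` N) + card ((\<lambda>(x, \<rho>). x $ k + \<rho> / 2) ` N)"
          unfolding H_def by (rule card_Un_le)
        also have "\<dots> \<le> card N + card N" using N by (intro add_mono card_image_le)
        finally show "card (H k) \<le> Q + Q" using N(2) by linarith
      qed
      define p q where "p k = max (lo u k) (lo v k)" and "q k = min (hi u k) (hi v k)" for k
      have pq: "p k \<le> q k" "width u v k = q k - p k" for k
        using pos[of k] by (auto simp: p_def q_def width_def)
      have "\<forall>k. \<exists>x y. p k \<le> x \<and> y \<le> q k \<and> (q k - p k) / 2 ^ (Q + Q) \<le> y - x \<and> H k \<inter> {x<..<y} = {}"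
        using subinterval_avoiding_finite[OF H pq(1)] by blast
      then obtain a' b' where ab': "\<And>k. p k \<le> a' k" "\<And>k. b' k \<le> q k"
        "\<And>k. (q k - p k) / 2 ^ (Q + Q) \<le> b' k - a' k" "\<And>k. H k \<inter> {a' k<..<b' k} = {}"
        by metis
      \<comment> \<open>Tiny coordinates keep the whole overlap; the others keep a subinterval that
        no face of a nearby cell cuts.\<close>
      define a b where "a k = (if k \<in> T then p k else a' k)" and "b k = (if k \<in> T then q k else b' k)" for k
      have ab_in: "p k \<le> a k" "b k \<le> q k" for k using ab' by (auto simp: a_def b_def)
      have ab_wide: "c' * \<alpha> \<le> b k - a k" if "k \<notin> T" for k
      proof -
        have "c * \<alpha> / 2 ^ (Q + Q) \<le> (q k - p k) / 2 ^ (Q + Q)"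
          using that pq(2)[of k] by (intro divide_right_mono) (auto simp: T_def)
        then show ?thesis using ab'(3)[of k] that by (simp add: a_def b_def c'_def)
      qed
      have ab: "a k < b k" for k
      proof (cases "k \<in> T")
        case True
        then show ?thesis using pos[of k] pq(2)[of k] by (simp add: a_def b_def)
      next
        case False
        then show ?thesis using ab_wide[OF False] c' \<alpha> mult_pos_pos[OF c' \<alpha>] by linarith
      qed
      have near_u: "\<bar>a k - centre u $ k\<bar> \<le> \<alpha>" "\<bar>b k - centre u $ k\<bar> \<le> \<alpha>" for k
        using ab_in[of k] ab[of k] Lambda_rat[OF u \<alpha>] unfolding p_def q_def lo_def hi_def by linarith+
      have meets: "meets T a b u v"
        using ab'(1,2) unfolding meets_def by (auto simp: a_def b_def p_def q_def)
      have False
      proof (rule no_tiny_overlap[where \<alpha> = \<alpha> and C = "c' * \<alpha>" and E = "e * \<alpha>" and ?C4.0 = "c4 * \<alpha>"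
            and ?C5.0 = "c5 * \<alpha>" and ?C6.0 = "c6 * \<alpha>" and ?C7.0 = "c7 * \<alpha>" and ?G2.0 = "g2 * \<alpha>"
            and ?G5.0 = "g5 * \<alpha>" and T = T and a = a and b = b and z = "centre u" and m = m
            and \<sigma> = u and \<tau> = v and ?k0.0 = k0])
        show "card T \<le> Suc m" using card by (simp add: T_def)
        show "b k - a k < e * \<alpha>" if "k \<in> T" for k
          using 3(2)[OF that] pq(2)[of k] that by (simp add: a_def b_def)
        show "e * \<alpha> \<le> rmin * \<alpha> / 4" "c4 * \<alpha> \<le> rmin * \<alpha> / 4" "c6 * \<alpha> \<le> rmin * \<alpha> / 4"
          using e(3) c4 c6 \<alpha> mult_right_mono[of _ "rmin / 4" \<alpha>] by fastforce+
        show "e * \<alpha> \<le> g5 * \<alpha>" "e * \<alpha> \<le> g2 * \<alpha>" "c6 * \<alpha> \<le> g5 * \<alpha>"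
          using e c6 \<alpha> by (auto intro: mult_right_mono)
      next
        fix w k assume w: "w \<in> Lambda n r \<alpha>" "norm (centre w - centre u) \<le> CARD('d) * (3 * \<alpha>)" "k \<notin> T"
        then have "(centre w, rat w) \<in> N" by (auto simp: N_def R_def)
        then have "lo w k \<in> H k" "hi w k \<in> H k"
          unfolding H_def lo_def hi_def by force+
        then show "lo w k \<notin> {a k<..<b k} \<and> hi w k \<notin> {a k<..<b k}"
          using ab'(4)[of k] w(3) by (auto simp: a_def b_def)
      next
        fix w w' k assume w: "w \<in> Lambda n r \<alpha>" "w' \<in> Lambda n r \<alpha>"
          and "\<And>k. min (c' * \<alpha>) (rmin * \<alpha> / 4) \<le> width w w' k"
        then have "\<forall>k. min c' (rmin / 4) * \<alpha> \<le> width w w' k"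
          using \<alpha> by (simp add: min_mult_distrib_right)
        moreover have "c4 * \<alpha> \<le> g4 * \<alpha>" using c4 \<alpha> by (intro mult_right_mono) auto
        ultimately show "(lo w' k \<noteq> lo w k \<longrightarrow> c4 * \<alpha> \<le> \<bar>lo w' k - lo w k\<bar>) \<and>
            (hi w' k \<noteq> hi w k \<longrightarrow> c4 * \<alpha> \<le> \<bar>hi w' k - hi w k\<bar>)"
          using g4(2) \<alpha> w by (meson order_trans)
      next
        fix w w' k assume "w \<in> Lambda n r \<alpha>" "w' \<in> Lambda n r \<alpha>" "\<And>k. 0 < width w w' k"
          "card {k. width w w' k < min (c' * \<alpha>) (c4 * \<alpha>)} \<le> m"
        then show "c5 * \<alpha> \<le> width w w' k"
          using \<alpha> by (intro width_boundD[OF c5(2)]) (auto simp: min_mult_distrib_right)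
      next
        fix w w' k assume "w \<in> Lambda n r \<alpha>" "w' \<in> Lambda n r \<alpha>" "\<And>k. 0 < width w w' k"
          "card {k. width w w' k < min (c' * \<alpha>) (c6 * \<alpha>)} \<le> m"
        then show "c7 * \<alpha> \<le> width w w' k"
          using \<alpha> by (intro width_boundD[OF c7(2)]) (auto simp: min_mult_distrib_right)
      next
        fix w w' k assume "w \<in> Lambda n r \<alpha>" "w' \<in> Lambda n r \<alpha>" "\<And>k. c5 * \<alpha> \<le> width w w' k"
        then show "(lo w' k \<noteq> lo w k \<longrightarrow> g5 * \<alpha> \<le> \<bar>lo w' k - lo w k\<bar>) \<and>
            (hi w' k \<noteq> hi w k \<longrightarrow> g5 * \<alpha> \<le> \<bar>hi w' k - hi w k\<bar>)"
          using g5(2) \<alpha> by blast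
      next
        fix w1 w2 w3 k assume w: "w1 \<in> Lambda n r \<alpha>" "w2 \<in> Lambda n r \<alpha>" "w3 \<in> Lambda n r \<alpha>"
          "\<And>k. c7 * \<alpha> \<le> width w1 w2 k" "\<And>k. c5 * \<alpha> \<le> width w2 w3 k" "width w1 w3 k \<noteq> 0"
        have "rel w1 w2 \<in> rels c7" "rel w2 w3 \<in> rels c5"
          using w \<alpha> by (auto intro!: relsI)
        then have "rel w1 w3 \<in> Z"
          unfolding Z_def rel_trans[OF Lambda_words[OF w(1)] Lambda_words[OF w(2)], of w3]
          by (intro image_eqI[of _ _ "(rel w1 w2, rel w2 w3)"]) auto
        then show "g2 * \<alpha> \<le> \<bar>width w1 w3 k\<bar>"
          using g2(2) \<alpha> Lambda_words[OF w(1)] Lambda_rat(2)[OF w(1) \<alpha>] w(6) by blast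
      next
        fix w i j k assume w: "w \<in> words n" "i \<le> n" "j \<le> n" "rmin * \<alpha> \<le> rat (w @ [i])"
          "width (w @ [i]) (w @ [j]) k \<noteq> 0"
        moreover have "w @ [i] \<in> words n" using w by simp
        ultimately have "g0 * \<alpha> \<le> \<bar>width (w @ [i]) (w @ [j]) k\<bar>"
          using g0(2) \<alpha> by blast
        moreover have "e * \<alpha> \<le> g0 * \<alpha>" using e \<alpha> by (intro mult_right_mono) auto
        ultimately show "e * \<alpha> \<le> \<bar>width (w @ [i]) (w @ [j]) k\<bar>" by linarith
      qed (use \<alpha> ab ab_wide near_u u v meets 3 in auto)
      then show ?thesis ..
    qed
  qed
  then have "width_bound (Suc m) c (min c \<epsilon>)" unfolding width_bound_def by blast
  then show ?case using Suc.prems \<epsilon> by (intro exI[of _ "min c \<epsilon>"]) auto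
qed

subsection \<open>Neighbour maps\<close>

lemma interior_unit_cube: "interior unit_cube = {x :: real ^ 'd. \<forall>k. \<bar>x $ k\<bar> < 1/2}"
proof -
  have "(- 1/2 < x $ k \<and> x $ k < 1/2) = (\<bar>x $ k\<bar> < 1/2)" for x :: "real ^ 'd" and k by linarith
  then show ?thesis unfolding unit_cube_def interior_cbox by (auto simp: mem_box_cart)
qed

text \<open>The image of the interior is open, by surjectivity, and contained in the cube.\<close>

lemma cube_isometry_interior:
  fixes M :: "real ^ 'd ^ 'd"
  assumes M: "M \<in> cube_isometries"
  shows "(\<lambda>x. M *v x) ` interior unit_cube \<subseteq> interior unit_cube"
proof (rule interior_maximal)
  show "(\<lambda>x. M *v x) ` interior unit_cube \<subseteq> unit_cube"
    using M interior_subset[of unit_cube] by (auto simp: cube_isometries_def)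
  have "M *v (transpose M *v x) = x" for x
    using M unfolding matrix_vector_mul_assoc by (simp add: cube_isometries_def orthogonal_matrix_def)
  then have "surj (\<lambda>x. M *v x)" by (metis surjI)
  then show "open ((\<lambda>x. M *v x) ` interior unit_cube)"
    by (intro open_surjective_linear_image) auto
qed

lemma word_map_interior:
  assumes "u \<in> words n" "x \<in> interior unit_cube"
  shows "lo u k < word_map S u x $ k" "word_map S u x $ k < hi u k"
proof -
  have "\<bar>(lin u *v x) $ k\<bar> < 1/2"
    using cube_isometry_interior[OF lin_in[OF assms(1)]] assms(2) unfolding interior_unit_cube by blast
  then have "\<bar>rat u * (lin u *v x) $ k\<bar> < rat u / 2"
    using rat_pos[OF assms(1)] by (simp add: abs_mult)
  moreover have "word_map S u x $ k = rat u * (lin u *v x) $ k + centre u $ k"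
    by (simp add: word_map_eq[OF assms(1)])
  ultimately show "lo u k < word_map S u x $ k" "word_map S u x $ k < hi u k"
    unfolding lo_def hi_def by linarith+
qed

text \<open>Intersecting images of the open cube overlap with positive width in every coordinate, so
  \<open>width_bound_ex\<close> and \<open>finite_rel\<close> leave finitely many relative
  positions. Together with the two linear parts these determine the neighbour map.\<close>

lemma finite_neighbour_maps: "finite (neighbour_maps n r S (interior unit_cube))"
proof -
  obtain \<epsilon> where \<epsilon>: "0 < \<epsilon>" "width_bound CARD('d) 1 \<epsilon>"
    using width_bound_ex[of 1 "CARD('d)"] by auto
  \<comment> \<open>The neighbour map in coordinates: apply the second linear part, scale and shift
    by the relative position, then undo the first linear part by its transpose.\<close>
  define h where "h = (\<lambda>((\<rho> :: real, c), M :: real ^ 'd ^ 'd, M' :: real ^ 'd ^ 'd) y.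
    transpose M *v (\<rho> *\<^sub>R (M' *v y) + c))"
  have "finite (rels \<epsilon> \<times> cube_isometries \<times> (cube_isometries :: (real ^ 'd ^ 'd) set))"
    unfolding rels_def by (intro finite_cartesian_product finite_rel[OF \<epsilon>(1)] finite_cube_isometries)
  moreover have "neighbour_maps n r S (interior unit_cube) \<subseteq> h ` (rels \<epsilon> \<times> cube_isometries \<times> cube_isometries)"
  proof
    fix f assume "f \<in> neighbour_maps n r S (interior unit_cube)"
    then obtain \<alpha> u v where \<alpha>: "0 < \<alpha>" and f: "f = inv (word_map S u) \<circ> word_map S v"
      and u: "u \<in> Lambda n r \<alpha>" and v: "v \<in> Lambda n r \<alpha>"
      and ne: "word_map S u ` interior unit_cube \<inter> word_map S v ` interior unit_cube \<noteq> {}"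
      unfolding neighbour_maps_def by blast
    note uw = Lambda_words[OF u] and vw = Lambda_words[OF v]
    note ru = rat_pos[OF uw]
    obtain x y where xy: "x \<in> interior unit_cube" "y \<in> interior unit_cube" "word_map S u x = word_map S v y"
      using ne by auto
    have "0 < width u v k" for k
      using word_map_interior[OF uw xy(1), of k] word_map_interior[OF vw xy(2), of k] xy(3)
      by (auto simp: width_def)
    moreover have "card {k. width u v k < 1 * \<alpha>} \<le> CARD('d)" by (intro card_mono) auto
    ultimately have "\<epsilon> * \<alpha> \<le> width u v k" for k
      using width_boundD[OF \<epsilon>(2) \<alpha> u v] by blast
    then have "rel u v \<in> rels \<epsilon>" using \<alpha> u v by (intro relsI) auto
    have M: "transpose (lin u) ** lin u = mat 1" "lin u ** transpose (lin u) = mat 1"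
      using lin_in[OF uw] by (auto simp: cube_isometries_def orthogonal_matrix_def)
    define g where "g = (\<lambda>y. (1 / rat u) *\<^sub>R (transpose (lin u) *v (y - centre u)))"
    have "inv (word_map S u) = g"
    proof (rule inv_equality)
      show "g (word_map S u x) = x" for x
        using ru by (simp add: g_def word_map_eq[OF uw] matrix_vector_mult_scaleR matrix_vector_mul_assoc M
            del: transpose_matrix_vector)
      show "word_map S u (g y) = y" for y
        using ru by (simp add: g_def word_map_eq[OF uw] matrix_vector_mult_scaleR matrix_vector_mul_assoc M
            del: transpose_matrix_vector)
    qed
    then have "f y = h (rel u v, lin u, lin v) y" for y
    proof -
      assume inv: "inv (word_map S u) = g"
      have "(1 / rat u) *\<^sub>R (rat v *\<^sub>R (lin v *v y) + centre v - centre u)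
          = (rat v / rat u) *\<^sub>R (lin v *v y) + (1 / rat u) *\<^sub>R (centre v - centre u)"
        by (simp add: scaleR_add_right scaleR_diff_right)
      then show ?thesis
        by (simp add: f inv g_def h_def rel_def word_map_eq[OF vw] del: transpose_matrix_vector
            flip: matrix_vector_mult_scaleR)
    qed
    then have "f = h (rel u v, lin u, lin v)" by blast
    then show "f \<in> h ` (rels \<epsilon> \<times> cube_isometries \<times> cube_isometries)"
      using \<open>rel u v \<in> rels \<epsilon>\<close> lin_in[OF uw] lin_in[OF vw] by blast
  qed
  ultimately show ?thesis by (rule finite_surj)
qed

lemma gftc_co: "gftc_co n r S"
proof -
  have "attractor n S = unit_cube"
    using ratio S_lipschitz attr by (intro attractor_eqI[where r = r]) (auto intro: less_imp_le)
  moreover have "convex hull unit_cube = (unit_cube :: (real ^ 'd) set)"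
    unfolding unit_cube_def by (intro convex_hull_eq[THEN iffD2] convex_box)
  moreover have "(0 :: real ^ 'd) \<in> interior unit_cube" by (simp add: interior_unit_cube)
  moreover have "bounded (interior (unit_cube :: (real ^ 'd) set))"
    using bounded_subset[OF bounded_cbox interior_subset] by (simp add: unit_cube_def)
  moreover have "S i ` interior unit_cube \<subseteq> interior unit_cube" if "i \<le> n" for i
  proof
    fix y assume "y \<in> S i ` interior unit_cube"
    then obtain x where x: "x \<in> interior unit_cube" "y = word_map S [i] x" by auto
    \<comment> \<open>The cell of the empty word is the whole cube, so \<open>lo_hi_append\<close>
      with an empty prefix bounds the faces of \<open>[i]\<close>.\<close>
    have "\<bar>y $ k\<bar> < 1/2" for k
      using word_map_interior[of "[i]" x k] x that lo_hi_append[of "[]" "[i]" k]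
      by (simp add: lo_def hi_def abs_less_iff)
    then show "y \<in> interior unit_cube" by (simp add: interior_unit_cube)
  qed
  ultimately show ?thesis
    using finite_neighbour_maps unfolding gftc_co_def gftc_def by auto
qed

end

theorem theorem4p3:
  fixes n :: nat
    and r :: "nat \<Rightarrow> real"
    and A :: "nat \<Rightarrow> real ^ 'd ^ 'd"
    and t :: "nat \<Rightarrow> real ^ 'd"
    and S :: "nat \<Rightarrow> real ^ 'd \<Rightarrow> real ^ 'd"
  assumes S: "\<And>i x. i \<le> n \<Longrightarrow> S i x = r i *\<^sub>R (A i *v x) + t i"
    and ratio: "\<And>i. i \<le> n \<Longrightarrow> 0 < r i \<and> r i < 1"
    and orth: "\<And>i. i \<le> n \<Longrightarrow> orthogonal_matrix (A i)"
    and attr: "is_attractor n S unit_cube"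
    and fixes_cube: "\<And>i. i \<le> n \<Longrightarrow> (\<lambda>x. A i *v x) ` unit_cube = unit_cube"
    and wsc: "weak_separation n r S"
  shows "gftc_co n r S"
proof -
  interpret cube_ifs n r A t S
    using assms by unfold_locales
  show ?thesis by (rule gftc_co)
qed

end
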